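(* The Riemann zeta function $\zeta(s)$ does not satisfy any nontrivial algebraic difference equation whose coefficients are meromorphic functions $\phi$ on $\mathbb{C}$ with Nevanlinna order $\rho(\phi) < 1$. That is: let $m$ be a nonnegative integer, let $s_0, \dots, s_m \in \mathbb{C}$ be distinct, and let $f(s, z_0, \dots, z_m)$ be a polynomial in $z_0, \dots, z_m$ whose coefficients are meromorphic functions $\phi(s)$ on $\mathbb{C}$, each with $\rho(\phi) < 1$. If $f\bigl(s, \zeta(s+s_0), \dots, \zeta(s+s_m)\bigr) = 0$ for all $s \in \mathbb{C}$, then $f$ is identically zero.
   Context: $\zeta$ denotes the Riemann zeta function, regarded as a meromorphic function on $\mathbb{C}$. The equation is understood as an identity between meromorphic functions of $s$ on $\mathbb{C}$; "$f$ is identically zero" means that $f$ is the zero polynomial in $z_0,\dots,z_m$, i.e. every coefficient is the identically zero function. For a meromorphic function $\phi$ on $\mathbb{C}$, the Nevanlinna characteristic is $T(r,\phi) = N(r,\phi) + m(r,\phi)$, where $$N(r,\phi) = \int_0^r \frac{n(t,\phi) - n(0,\phi)}{t}\,dt + n(0,\phi)\log r,$$ $n(r,\phi)$ is the number of poles of $\phi$, counted with multiplicity, in the disc $\{z : |z| \le r\}$, and $$m(r,\phi) = \frac{1}{2\pi}\int_0^{2\pi} \log^+ |\phi(re^{i\theta})|\, d\theta, \qquad \log^+ x = \max\{0, \log x\}.$$ The Nevanlinna order of $\phi$ is $$\rho(\phi) = \limsup_{r\to\infty} \frac{\log T(r,\phi)}{\log r}$$ (with $\log 0 = -\infty$, so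 that functions with bounded characteristic, in particular constants, satisfy $\rho(\phi)<1$). *)

theory Defs
  imports
    "HOL-Complex_Analysis.Complex_Analysis"
    "HOL-Library.Poly_Mapping"
    "HOL-Library.Function_Algebras"
begin

text \<open>
  The zeta function is the unique meromorphic continuation of its Dirichlet series to the
  complex plane. Asking for \<^const>\<open>nicely_meromorphic_on\<close> rather than
  \<^const>\<open>meromorphic_on\<close> only pins down the value at the pole (it is \<open>0\<close> there), so that the
  description is unique as a total function.
\<close>

definition riemann_zeta :: "complex \<Rightarrow> complex" where
  "riemann_zeta = (THE Z. Z nicely_meromorphic_on UNIV \<and>
     (\<forall>s. Re s > 1 \<longrightarrow> Z s = suminf (\<lambda>n. 1 / of_nat (Suc n) powr s)))"

definition pole_count :: "real \<Rightarrow> (complex \<Rightarrow> complex) \<Rightarrow> nat" where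
  "pole_count r \<phi> = (\<Sum>z \<in> {z. norm z \<le> r \<and> is_pole \<phi> z}. nat (- zorder \<phi> z))"

definition nevanlinna_N :: "real \<Rightarrow> (complex \<Rightarrow> complex) \<Rightarrow> real" where
  "nevanlinna_N r \<phi> =
     integral {0..r} (\<lambda>t. (real (pole_count t \<phi>) - real (pole_count 0 \<phi>)) / t)
       + real (pole_count 0 \<phi>) * ln r"

text \<open>Since \<open>ln 0 = 0\<close> for real numbers, \<open>ln_plus 0 = 0\<close> as required.\<close>

definition ln_plus :: "real \<Rightarrow> real" where
  "ln_plus x = max 0 (ln x)"

definition nevanlinna_m :: "real \<Rightarrow> (complex \<Rightarrow> complex) \<Rightarrow> real" where
  "nevanlinna_m r \<phi> =
     1 / (2 * pi) * integral {0..2 * pi} (\<lambda>\<theta>. ln_plus (norm (\<phi> (of_real r * cis \<theta>))))"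

definition nevanlinna_T :: "real \<Rightarrow> (complex \<Rightarrow> complex) \<Rightarrow> real" where
  "nevanlinna_T r \<phi> = nevanlinna_N r \<phi> + nevanlinna_m r \<phi>"

text \<open>
  Logarithm with \<open>log 0 = -\<infinity>\<close>. Its value at negative arguments is irrelevant, as the
  characteristic of a meromorphic function is nonnegative for \<open>r \<ge> 1\<close>.
\<close>

definition ln_ext :: "real \<Rightarrow> ereal" where
  "ln_ext x = (if x \<le> 0 then - \<infinity> else ereal (ln x))"

definition nevanlinna_order :: "(complex \<Rightarrow> complex) \<Rightarrow> ereal" where
  "nevanlinna_order \<phi> = Limsup at_top (\<lambda>r::real. ln_ext (nevanlinna_T r \<phi>) / ereal (ln r))"

text \<open>
  A polynomial in the variables \<open>z\<^sub>0, \<dots>, z\<^sub>m\<close> whose coefficients are functions of \<open>s\<close> is a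
  finitely supported map from monomials to functions, a monomial being a finitely supported
  map from variable indices to exponents.
\<close>

type_synonym fun_mpoly = "(nat \<Rightarrow>\<^sub>0 nat) \<Rightarrow>\<^sub>0 (complex \<Rightarrow> complex)"

definition vars_upto :: "nat \<Rightarrow> fun_mpoly \<Rightarrow> bool" where
  "vars_upto m f \<longleftrightarrow> (\<forall>\<alpha> \<in> Poly_Mapping.keys f. Poly_Mapping.keys \<alpha> \<subseteq> {..m})"

definition eval_fun_mpoly :: "nat \<Rightarrow> fun_mpoly \<Rightarrow> complex \<Rightarrow> (nat \<Rightarrow> complex) \<Rightarrow> complex" where
  "eval_fun_mpoly m f s z =
     (\<Sum>\<alpha> \<in> Poly_Mapping.keys f.
        Poly_Mapping.lookup f \<alpha> s * (\<Prod>j\<le>m. z j ^ Poly_Mapping.lookup \<alpha> j))"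

end

theory Submission
  imports Defs "HOL-Real_Asymp.Real_Asymp"
begin

text \<open>
  For large \<open>Re s\<close> the equation reads \<open>\<Sum>\<^sub>n A\<^sub>n(s) n\<^sup>-\<^sup>s = 0\<close> with
  \<open>A\<^sub>n = \<Sum>\<^sub>\<alpha> a\<^sub>\<alpha>(n) \<phi>\<^sub>\<alpha>\<close>, where \<open>a\<^sub>\<alpha>(n)\<close> are the Dirichlet coefficients of
  \<open>\<Prod>\<^sub>j \<zeta>(s + s\<^sub>j) ^ \<alpha>\<^sub>j\<close>. If \<open>A\<^sub>N\<close> is the first of the \<open>A\<^sub>n\<close> that is not identically zero, then it
  is at most a constant times \<open>\<Sum>\<^sub>\<alpha> |\<phi>\<^sub>\<alpha>(s)| (N/(N+1)) ^ Re s\<close> on a right half-plane. Averaging \<open>ln |A\<^sub>N|\<close> over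
  circles, Jensen's formula then bounds \<open>\<Sum>\<^sub>\<alpha> T(r, \<phi>\<^sub>\<alpha>)\<close> from below by a positive multiple of \<open>r\<close>,
  which is impossible for orders below 1. Hence all \<open>A\<^sub>n\<close> vanish.

  It remains to see that the arithmetic functions \<open>a\<^sub>\<alpha>\<close> are linearly independent. They are
  multiplicative, so Artin's argument for characters applies as soon as any two of them differ at
  powers of infinitely many primes. The Euler factors \<open>\<Prod>\<^sub>j (1 - x\<^sub>j X) ^ (-\<alpha>\<^sub>j)\<close> with
  \<open>x\<^sub>j = p powr (- s\<^sub>j)\<close> determine \<open>\<alpha>\<close> whenever the \<open>x\<^sub>j\<close> are distinct, and two given ones coincide
  for at most one prime \<open>p\<close>, since \<open>ln p / ln q\<close> is irrational for distinct primes.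
\<close>

section \<open>Jensen's formula\<close>

text \<open>By compactness, the open set where \<open>H\<close> is holomorphic and nonzero contains
  a neighbourhood of some width \<open>e\<close> around the whole disc. The larger ball is open and
  simply connected, as the existence of a logarithm requires.\<close>

lemma nonvanishing_on_larger_ball:
  assumes H: "H analytic_on cball 0 r" and r: "0 < r" and nz: "\<And>z. norm z \<le> r \<Longrightarrow> H z \<noteq> 0"
  obtains R where "R > r" "H holomorphic_on ball 0 R" "\<And>z. norm z < R \<Longrightarrow> H z \<noteq> (0::complex)"
proof -
  obtain U where U: "open U" "cball 0 r \<subseteq> U" "H holomorphic_on U"
    using H analytic_on_holomorphic by blast
  define V where "V = {z\<in>U. H z \<noteq> 0}"
  have V: "open V"
    unfolding V_def using continuous_open_preimage[OF holomorphic_on_imp_continuous_on[OF U(3)] U(1), of "-{0}"]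
    by (simp add: vimage_def Int_def open_Compl)
  have "cball 0 r \<subseteq> V"
    using U nz by (auto simp: V_def)
  then obtain e where e: "e > 0" "(\<Union>x\<in>cball 0 r. ball x e) \<subseteq> V"
    using compact_subset_open_imp_ball_epsilon_subset[OF compact_cball V] by metis
  have sub: "z \<in> V" if z: "norm z < r + e" for z
  proof (cases "norm z \<le> r")
    case True
    then show ?thesis using \<open>cball 0 r \<subseteq> V\<close> by auto
  next
    case False
    \<comment> \<open>\<open>x\<close> is the radial projection of \<open>z\<close> to the circle of
      radius \<open>r\<close>; its distance from \<open>z\<close> is \<open>norm z - r\<close>,
      hence below \<open>e\<close>.\<close>
    define x where "x = of_real (r / norm z) * z"
    have [simp]: "norm z > 0" "z \<noteq> 0" using False r by auto
    have "norm x = r" using r by (simp add: x_def norm_mult norm_divide)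
    then have "x \<in> cball 0 r" by simp
    moreover have "z \<in> ball x e"
    proof -
      have "x - z = of_real (r / norm z - 1) * z" by (simp add: x_def algebra_simps of_real_diff)
      then have "norm (x - z) = \<bar>r / norm z - 1\<bar> * norm z" by (simp only: norm_mult norm_of_real)
      also have "\<dots> = norm z - r" using False r by (simp add: abs_if field_simps)
      finally show ?thesis using z by (simp add: dist_norm)
    qed
    ultimately show ?thesis using e(2) by blast
  qed
  show ?thesis
  proof (rule that[of "r + e"])
    show "H holomorphic_on ball 0 (r + e)"
      using U(3) by (rule holomorphic_on_subset) (use sub in \<open>auto simp: V_def\<close>)
  qed (use e sub in \<open>auto simp: V_def\<close>)
qed

text \<open>A holomorphic logarithm \<open>L\<close> of \<open>H\<close> exists on a slightly larger
  ball, and ln |H| is its real part. Cauchy's integral formula for \<open>L\<close> at the centre is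
  the mean value property.\<close>

lemma ln_norm_mean_value:
  assumes H: "H analytic_on cball 0 r" and r: "0 < r" and nz: "\<And>z. norm z \<le> r \<Longrightarrow> H z \<noteq> (0::complex)"
  shows "((\<lambda>\<theta>. ln (norm (H (of_real r * cis \<theta>)))) has_integral (2 * pi * ln (norm (H 0)))) {0..2*pi}"
proof -
  obtain R where R: "R > r" "H holomorphic_on ball 0 R" "\<And>z. norm z < R \<Longrightarrow> H z \<noteq> 0"
    using nonvanishing_on_larger_ball[OF assms] by metis
  obtain L where L: "L holomorphic_on ball 0 R" "\<And>z. z \<in> ball 0 R \<Longrightarrow> exp (L z) = H z"
    using holomorphic_logarithm_exists[of "ball 0 R" H 0] R r by auto
  have "((\<lambda>u. L u / (u - 0)) has_contour_integral (2 * of_real pi * \<i> * L 0)) (circlepath 0 r)"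
    by (rule Cauchy_integral_circlepath_simple) (use L(1) R(1) r in \<open>auto elim!: holomorphic_on_subset\<close>)
  then have "((\<lambda>t. L (of_real r * cis t) / (of_real r * cis t) * r * \<i> * cis t) has_integral (2 * of_real pi * \<i> * L 0)) {0..2*pi}"
    unfolding circlepath_def by (subst (asm) has_contour_integral_part_circlepath_iff) auto
  then have "((\<lambda>t. - \<i> * (L (of_real r * cis t) / (of_real r * cis t) * r * \<i> * cis t)) has_integral
      (- \<i> * (2 * of_real pi * \<i> * L 0))) {0..2*pi}"
    by (rule has_integral_mult_right)
  moreover have "- \<i> * (L (of_real r * cis t) / (of_real r * cis t) * r * \<i> * cis t) = L (of_real r * cis t)" for t
    using r by (simp add: field_simps)
  moreover have "- \<i> * (2 * of_real pi * \<i> * L 0) = 2 * of_real pi * L 0"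
    by simp
  ultimately have "((\<lambda>t. L (of_real r * cis t)) has_integral (2 * of_real pi * L 0)) {0..2*pi}"
    by (simp only:)
  from has_integral_Re[OF this]
  have "((\<lambda>t. Re (L (of_real r * cis t))) has_integral (2 * pi * Re (L 0))) {0..2*pi}"
    by simp
  moreover have "Re (L z) = ln (norm (H z))" if "norm z < R" for z
    using L(2)[of z] that by (metis mem_ball_0 ln_exp norm_exp_eq_Re)
  ultimately show ?thesis
    using R(1) r by (simp add: norm_mult)
qed

text \<open>On the circle \<open>z * cnj z = r^2\<close>, so the reflected factor equals
  \<open>(cnj z - cnj w) * z / r\<close>, and \<open>z / r\<close> has modulus 1.\<close>

lemma norm_reflected_factor:
  assumes "norm z = r" "r > 0"
  shows "norm (of_real r - cnj w * z / of_real r) = norm (z - w)"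
proof -
  have "cnj z * z = of_real (r ^ 2)"
    using assms complex_norm_square[of z] by (simp add: mult.commute)
  then have "of_real r - cnj w * z / of_real r = (cnj z - cnj w) * z / of_real r"
    using assms by (simp add: field_simps power2_eq_square)
  then have "norm (of_real r - cnj w * z / of_real r) = norm (cnj (z - w)) * norm z / r"
    using assms by (simp add: norm_mult norm_divide)
  then show ?thesis using assms complex_mod_cnj[of "z - w"] by simp
qed

text \<open>A nicely meromorphic function takes the value 0 at its poles. So \<open>S\<close> holds
  the poles in the ball together with the zeros, told apart by the sign of \<open>zorder\<close>,
  and \<open>circ\<close> keeps poles as well as zeros off the circle.\<close>

lemma jensen_formula:
  assumes g: "g nicely_meromorphic_on UNIV" and g0: "g 0 \<noteq> 0" and r: "0 < r"
    and circ: "\<And>z. norm z = r \<Longrightarrow> g z \<noteq> 0"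
  defines "S \<equiv> {w \<in> ball 0 r. g w = 0}"
  shows "finite S"
    and "((\<lambda>\<theta>. ln (norm (g (of_real r * cis \<theta>)))) has_integral
           (2 * pi * (ln (norm (g 0)) + (\<Sum>w\<in>S. zorder g w * ln (r / norm w))))) {0..2*pi}"
proof -
  have mero: "g meromorphic_on UNIV" using g by (simp add: nicely_meromorphic_on_def)
  have ev: "\<forall>\<^sub>\<approx>x\<in>UNIV. g x \<noteq> 0"
    using nicely_meromorphic_imp_constant_or_avoid[OF g, of 0] g0 by auto
  have ev': "eventually (\<lambda>x. g x \<noteq> 0) (at z)" for z
    using eventually_cosparse_imp_eventually_at[OF ev] by auto
  have "finite (cball 0 r \<inter> {x. g x = 0})"
    by (rule sparse_in_compact_finite) (use ev in \<open>auto simp: eventually_cosparse intro: sparse_in_subset\<close>)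
  then show fin: "finite S"
    by (rule finite_subset[rotated]) (auto simp: S_def)
  have ana: "g analytic_on {z}" if "g z \<noteq> 0" for z
    using that g by (metis UNIV_I nicely_meromorphic_on_imp_analytic_at
        is_pole_zero_at_nicely_mero nicely_meromorphic_on_subset subset_UNIV)
  \<comment> \<open>Dividing out every zero and pole in the ball leaves order 0 at each point of the
    closed disc. The formula for \<open>G\<close> yields the value 0 at the points of
    \<open>S\<close>; \<open>remove_sings\<close> replaces it by the limit.\<close>
  define G where "G = (\<lambda>z. g z * (\<Prod>w\<in>S. (z - w) powi (- zorder g w)))"
  define H where "H = remove_sings G"
  have meroG: "G meromorphic_on A" for A
    unfolding G_def by (intro meromorphic_intros meromorphic_on_subset[OF mero]) auto
  have evP: "eventually (\<lambda>x. (\<Prod>w\<in>S. (x - w) powi (- zorder g w)) \<noteq> 0) (at z)" for z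
  proof -
    have "eventually (\<lambda>x. \<forall>w\<in>S. x \<noteq> w) (at z)"
      using fin by (simp add: eventually_ball_finite_distrib eventually_neq_at_within)
    then show ?thesis by eventually_elim (use fin in auto)
  qed
  have evG: "eventually (\<lambda>x. G x \<noteq> 0) (at z)" for z
    using evP[of z] ev'[of z] by eventually_elim (simp add: G_def)
  have zord: "zorder G z = 0" if z: "z \<in> cball 0 r" for z
  proof -
    have "zorder (\<lambda>x. \<Prod>w\<in>S. (x - w) powi (- zorder g w)) z = (\<Sum>w\<in>S. zorder (\<lambda>x. (x - w) powi (- zorder g w)) z)"
      by (rule zorder_prod) (use evP in \<open>auto intro!: meromorphic_intros\<close>)
    also have "\<dots> = (\<Sum>w\<in>S. if w = z then - zorder g z else 0)"
    proof (rule sum.cong)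
      fix w assume "w \<in> S"
      have "zorder (\<lambda>x. (x - w) powi (- zorder g w)) z = - zorder g w * zorder (\<lambda>x. x - w) z"
        by (rule zorder_power_int) (auto intro!: meromorphic_intros eventually_frequently eventually_neq_at_within)
      also have "zorder (\<lambda>x. x - w) z = (if w = z then 1 else 0)"
      proof (cases "w = z")
        case True
        show ?thesis using True by (auto intro!: zorder_eqI[of UNIV _ "\<lambda>_. 1"])
      next
        case False
        then show ?thesis by (auto intro!: zorder_eq_0I analytic_intros)
      qed
      finally show "zorder (\<lambda>x. (x - w) powi (- zorder g w)) z = (if w = z then - zorder g z else 0)" by auto
    qed auto
    also have "\<dots> = (if z \<in> S then - zorder g z else 0)"
      using fin by simp
    finally have *: "zorder (\<lambda>x. \<Prod>w\<in>S. (x - w) powi (- zorder g w)) z = (if z \<in> S then - zorder g z else 0)" .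
    have "zorder G z = zorder g z + zorder (\<lambda>x. \<Prod>w\<in>S. (x - w) powi (- zorder g w)) z"
      unfolding G_def
      by (rule zorder_mult) (use ev' evP in \<open>auto intro!: meromorphic_intros meromorphic_on_subset[OF mero] eventually_frequently\<close>)
    moreover have "zorder g z = 0" if "z \<notin> S"
      using that z circ[of z] by (intro zorder_eq_0I ana) (auto simp: S_def)
    ultimately show ?thesis using * by auto
  qed
  have H: "H analytic_on {z} \<and> H z \<noteq> 0" if z: "z \<in> cball 0 r" for z
  proof -
    have ne: "not_essential G z" and iso: "isolated_singularity_at G z"
      using meroG[of "{z}"] by (auto simp: meromorphic_at_iff)
    have np: "\<not> is_pole G z"
      using isolated_pole_imp_neg_zorder[OF iso] zord[OF z] by auto
    have a: "H analytic_on {z}"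
      using np ne iso remove_sings_analytic_at unfolding H_def not_essential_def by blast
    have "eventually (\<lambda>w. H w = G w) (at z)"
      unfolding H_def by (rule eventually_remove_sings_eq_at[OF iso])
    then have "zorder H z = 0" and "eventually (\<lambda>w. H w \<noteq> 0) (at z)"
      using zord[OF z] zorder_cong[of H G z z] evG[of z] by (auto elim: eventually_elim2)
    moreover from this(2) have "frequently (\<lambda>w. H w \<noteq> 0) (at z)"
      by (rule eventually_frequently[rotated]) simp
    ultimately show ?thesis using a zorder_eq_0_iff[OF a] by blast
  qed
  \<comment> \<open>Replacing each factor \<open>z - w\<close> by its reflection in the circle removes the zeros and poles
    without changing the absolute value on the circle.\<close>
  define B where "B = (\<lambda>z. \<Prod>w\<in>S. (of_real r - cnj w * z / of_real r) powi zorder g w)"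
  \<comment> \<open>The reflected factor vanishes only if |w| |z| = r^2, which is impossible for |w|
    < r and |z| \<le> r.\<close>
  have b0: "of_real r - cnj w * z / of_real r \<noteq> 0" if "w \<in> S" "z \<in> cball 0 r" for w z
  proof
    assume "of_real r - cnj w * z / of_real r = 0"
    then have "cnj w * z = of_real r * of_real r" using r by (auto simp: field_simps)
    then have "norm w * norm z = r * r" using r by (metis complex_mod_cnj norm_mult norm_of_real abs_of_pos)
    moreover have "norm w * norm z \<le> norm w * r" using that by (intro mult_left_mono) auto
    moreover have "norm w * r < r * r" using that r by (auto simp: S_def)
    ultimately show False by simp
  qed
  have Ba: "B analytic_on cball 0 r"
    unfolding B_def by (intro analytic_intros) (use b0 r in auto)
  have Bn: "B z \<noteq> 0" if "z \<in> cball 0 r" for z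
    unfolding B_def using b0[OF _ that] fin by auto
  have I: "((\<lambda>\<theta>. ln (norm ((\<lambda>z. H z * B z) (of_real r * cis \<theta>)))) has_integral (2 * pi * ln (norm (H 0 * B 0)))) {0..2*pi}"
    by (rule ln_norm_mean_value)
       (use H Ba Bn r in \<open>auto intro!: analytic_on_mult simp: analytic_on_analytic_at[of _ "cball 0 r"]\<close>)
  have Gan: "H z = G z" if "g z \<noteq> 0" for z
  proof -
    have "z \<notin> S" using that by (auto simp: S_def)
    then show ?thesis unfolding H_def
      by (intro remove_sings_at_analytic) (auto simp: G_def intro!: analytic_intros ana that)
  qed
  have eq: "norm (H z * B z) = norm (g z)" if "norm z = r" for z
  proof -
    have "norm (B z) = (\<Prod>w\<in>S. norm (z - w) powi zorder g w)"
      unfolding B_def prod_norm[symmetric] norm_power_int using norm_reflected_factor[OF that r] by simp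
    moreover have "norm (G z) = norm (g z) * (\<Prod>w\<in>S. norm (z - w) powi (- zorder g w))"
      unfolding G_def norm_mult prod_norm[symmetric] norm_power_int by simp
    moreover have "(\<Prod>w\<in>S. norm (z - w) powi (- zorder g w)) * (\<Prod>w\<in>S. norm (z - w) powi zorder g w) = 1"
      unfolding prod.distrib[symmetric]
      using that by (intro prod.neutral) (auto simp: S_def power_int_minus intro!: left_inverse)
    ultimately show ?thesis using Gan[OF circ[OF that]] by (simp add: norm_mult mult.assoc)
  qed
  have nS: "w \<noteq> 0" if "w \<in> S" for w using that g0 by (auto simp: S_def)
  \<comment> \<open>At the centre each reflected factor equals \<open>r\<close>, while the original
    factor has modulus \<open>norm w\<close>; this produces the weights
    \<open>ln (r / norm w)\<close>.\<close>
  have "ln (norm (H 0 * B 0)) = ln (norm (g 0)) + (\<Sum>w\<in>S. zorder g w * ln (r / norm w))"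
  proof -
    have "norm (H 0 * B 0) = norm (g 0) * (\<Prod>w\<in>S. norm w powi (- zorder g w)) * (\<Prod>w\<in>S. r powi zorder g w)"
      using Gan[OF g0] r
      by (simp add: G_def B_def norm_mult norm_power_int flip: prod_norm)
    also have "\<dots> = norm (g 0) * (\<Prod>w\<in>S. (r / norm w) powi zorder g w)"
      unfolding mult.assoc prod.distrib[symmetric]
      by (simp add: power_int_minus power_int_divide_distrib field_simps)
    also have "ln \<dots> = ln (norm (g 0)) + ln (\<Prod>w\<in>S. (r / norm w) powi zorder g w)"
      using g0 nS r fin by (intro ln_mult_pos) (auto intro!: prod_pos)
    also have "ln (\<Prod>w\<in>S. (r / norm w) powi zorder g w) = (\<Sum>w\<in>S. ln ((r / norm w) powi zorder g w))"
      using nS r fin by (intro ln_prod) auto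
    also have "\<dots> = (\<Sum>w\<in>S. zorder g w * ln (r / norm w))"
    proof (rule sum.cong)
      fix w assume "w \<in> S"
      have "r / norm w > 0" using nS[OF \<open>w \<in> S\<close>] r by simp
      then show "ln ((r / norm w) powi zorder g w) = zorder g w * ln (r / norm w)"
        by (subst powr_real_of_int'[symmetric]) (use r nS[OF \<open>w \<in> S\<close>] in \<open>auto simp: ln_powr\<close>)
    qed auto
    finally show ?thesis .
  qed
  with I eq r show "((\<lambda>\<theta>. ln (norm (g (of_real r * cis \<theta>)))) has_integral
           (2 * pi * (ln (norm (g 0)) + (\<Sum>w\<in>S. zorder g w * ln (r / norm w))))) {0..2*pi}"
    by (simp add: norm_mult)
qed

section \<open>The Nevanlinna characteristic and functions of order less than 1\<close>

text \<open>The value 0 off the poles allows the multiplicities of several functions to be summed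
  over one common set of points.\<close>

definition pole_mult :: "(complex \<Rightarrow> complex) \<Rightarrow> complex \<Rightarrow> nat" where
  "pole_mult f w = (if is_pole f w then nat (- zorder f w) else 0)"

lemma finite_poles_cball:
  assumes "f meromorphic_on UNIV"
  shows "finite {w. norm w \<le> r \<and> is_pole f w}"
proof -
  have "finite (cball 0 r \<inter> {w. \<not> \<not> is_pole f w})"
    by (rule sparse_in_compact_finite)
       (use meromorphic_on_imp_not_pole_cosparse[OF assms] in \<open>auto simp: eventually_cosparse intro: sparse_in_subset\<close>)
  then show ?thesis by (rule finite_subset[rotated]) auto
qed

text \<open>Each nonzero pole \<open>w\<close> adds its multiplicity to the counting function from t
  = |w| onwards, and the integral of 1/t from |w| to r is ln (r / |w|).\<close>

lemma nevanlinna_N_eq: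
  assumes f: "f meromorphic_on UNIV" and r: "0 \<le> r"
  shows "nevanlinna_N r f = (\<Sum>w\<in>{w. norm w \<le> r \<and> is_pole f w \<and> w \<noteq> 0}. pole_mult f w * ln (r / norm w))
           + pole_mult f 0 * ln r"
proof -
  define P where "P = {w. norm w \<le> r \<and> is_pole f w \<and> w \<noteq> 0}"
  have fin: "finite P" unfolding P_def
    by (rule finite_subset[OF _ finite_poles_cball[OF f, of r]]) auto
  have count: "real (pole_count t f) = (\<Sum>w\<in>P. if norm w \<le> t then pole_mult f w else 0) + pole_mult f 0"
    if "0 \<le> t" "t \<le> r" for t
  proof -
    have fin': "finite {w\<in>P. norm w \<le> t}" using fin by simp
    have "pole_count t f = (\<Sum>w\<in>{w. norm w \<le> t \<and> is_pole f w}. pole_mult f w)"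
      unfolding pole_count_def by (rule sum.cong) (auto simp: pole_mult_def)
    also have "\<dots> = (\<Sum>w\<in>insert 0 {w\<in>P. norm w \<le> t}. pole_mult f w)"
      by (rule sum.mono_neutral_left) (use fin' that in \<open>auto simp: P_def pole_mult_def\<close>)
    also have "\<dots> = (\<Sum>w\<in>{w\<in>P. norm w \<le> t}. pole_mult f w) + pole_mult f 0"
      using fin' by (subst sum.insert) (auto simp: P_def)
    finally show ?thesis using fin by (simp add: sum.inter_filter)
  qed
  have c0: "real (pole_count 0 f) = pole_mult f 0"
  proof -
    have "(\<Sum>w\<in>P. if norm w \<le> 0 then pole_mult f w else 0) = 0"
      by (rule sum.neutral) (auto simp: P_def)
    then show ?thesis using count[of 0] r by simp
  qed
  show ?thesis
  proof -
    have I: "((\<lambda>t. pole_mult f w * (if t \<in> {norm w..r} then 1 / t else 0)) has_integral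
            pole_mult f w * ln (r / norm w)) {0..r}" if "w \<in> P" for w
    proof (rule has_integral_mult_right)
      have w: "0 < norm w" "norm w \<le> r" using that by (auto simp: P_def)
      have "((\<lambda>t. 1 / t) has_integral (ln r - ln (norm w))) {norm w..r}"
        by (rule fundamental_theorem_of_calculus)
           (use w in \<open>auto intro!: derivative_eq_intros elim: less_le_trans[rotated] simp: has_real_derivative_iff_has_vector_derivative[symmetric]\<close>)
      then have "((\<lambda>t. if t \<in> {norm w..r} then 1 / t else 0) has_integral (ln r - ln (norm w))) {0..r}"
        by (subst has_integral_restrict) (use w in auto)
      then show "((\<lambda>t. if t \<in> {norm w..r} then 1 / t else 0) has_integral (ln (r / norm w))) {0..r}"
        using w by (subst ln_div) auto
    qed
    have "((\<lambda>t. \<Sum>w\<in>P. pole_mult f w * (if t \<in> {norm w..r} then 1 / t else 0)) has_integral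
            (\<Sum>w\<in>P. pole_mult f w * ln (r / norm w))) {0..r}"
      by (intro has_integral_sum fin I)
    then have "((\<lambda>t. (real (pole_count t f) - real (pole_count 0 f)) / t) has_integral
            (\<Sum>w\<in>P. pole_mult f w * ln (r / norm w))) {0..r}"
    proof (rule has_integral_eq[rotated])
      fix t assume t: "t \<in> {0..r}"
      show "(\<Sum>w\<in>P. pole_mult f w * (if t \<in> {norm w..r} then 1 / t else 0)) =
            (real (pole_count t f) - real (pole_count 0 f)) / t"
        using t c0 by (auto simp: count sum_divide_distrib intro!: sum.cong)
    qed
    then show ?thesis
      unfolding nevanlinna_N_def P_def[symmetric] using c0 by (simp add: integral_unique)
  qed
qed

section \<open>Poles of linear combinations and a lower bound for logarithmic means\<close>

lemma meromorphic_times_power_tendsto: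
  assumes f: "f meromorphic_on {w}" and n: "pole_mult f w \<le> n"
  shows "\<exists>c. ((\<lambda>z. f z * (z - w) ^ n) \<longlongrightarrow> c) (at w)"
proof (cases "is_pole f w")
  case True
  have iso: "isolated_singularity_at f w" using f by (simp add: meromorphic_at_iff)
  obtain e where e: "e > 0" "f holomorphic_on ball w e - {w}"
    using iso analytic_imp_holomorphic unfolding isolated_singularity_at_def by blast
  obtain \<rho> where \<rho>: "\<rho> > 0" "zor_poly f w holomorphic_on cball w \<rho>"
    using zorder_exist_pole[OF e(2)] e(1) True by auto
  have "isCont (zor_poly f w) w"
    using holomorphic_on_imp_continuous_on[OF \<rho>(2)] \<rho>(1)
    by (metis centre_in_ball continuous_on_interior interior_cball)
  then have "((\<lambda>z. zor_poly f w z * (z - w) ^ (n - pole_mult f w)) \<longlongrightarrow> zor_poly f w w * (w - w) ^ (n - pole_mult f w)) (at w)"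
    unfolding isCont_def by (intro tendsto_intros)
  moreover have "eventually (\<lambda>z. zor_poly f w z * (z - w) ^ (n - pole_mult f w) = f z * (z - w) ^ n) (at w)"
    using zor_poly_pole_eq[OF iso True]
  proof eventually_elim
    case (elim z)
    have "(z - w) ^ pole_mult f w * (z - w) ^ (n - pole_mult f w) = (z - w) ^ n"
      using n by (simp flip: power_add)
    moreover have "nat (- zorder f w) = pole_mult f w" using True by (simp add: pole_mult_def)
    ultimately show ?case using elim by (simp add: mult.assoc)
  qed
  ultimately show ?thesis by (blast intro: Lim_transform_eventually)
next
  case False
  then obtain c where "(f \<longlongrightarrow> c) (at w)" using f by (auto simp: meromorphic_at_iff not_essential_def)
  then have "((\<lambda>z. f z * (z - w) ^ n) \<longlongrightarrow> c * (w - w) ^ n) (at w)"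
    by (intro tendsto_intros)
  then show ?thesis by blast
qed

text \<open>With \<open>n\<close> the sum of all pole multiplicities at \<open>w\<close>, the factor
  \<open>(z - w) ^ n\<close> gives every summand a finite limit, so its product with the whole sum
  has no pole. The sum of the multiplicities, as opposed to their maximum, matches the sum of the
  \<open>nevanlinna_N\<close> later on.\<close>

lemma zorder_sum_ge:
  assumes "finite K" and \<phi>: "\<And>\<alpha>. \<alpha> \<in> K \<Longrightarrow> \<phi> \<alpha> meromorphic_on {w}"
    and nz: "eventually (\<lambda>z. (\<Sum>\<alpha>\<in>K. c \<alpha> * \<phi> \<alpha> z) \<noteq> 0) (at w)"
  shows "zorder (\<lambda>z. \<Sum>\<alpha>\<in>K. c \<alpha> * \<phi> \<alpha> z) w \<ge> - int (\<Sum>\<alpha>\<in>K. pole_mult (\<phi> \<alpha>) w)"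
proof (rule ccontr)
  define A where "A = (\<lambda>z. \<Sum>\<alpha>\<in>K. c \<alpha> * \<phi> \<alpha> z)"
  define n where "n = (\<Sum>\<alpha>\<in>K. pole_mult (\<phi> \<alpha>) w)"
  assume "\<not> ?thesis"
  then have neg: "zorder A w + int n < 0" by (simp add: A_def n_def)
  have "\<exists>l. ((\<lambda>z. \<phi> \<alpha> z * (z - w) ^ n) \<longlongrightarrow> l) (at w)" if "\<alpha> \<in> K" for \<alpha>
    using that \<phi> assms(1) unfolding n_def
    by (intro meromorphic_times_power_tendsto member_le_sum) auto
  then obtain l where l: "\<And>\<alpha>. \<alpha> \<in> K \<Longrightarrow> ((\<lambda>z. \<phi> \<alpha> z * (z - w) ^ n) \<longlongrightarrow> l \<alpha>) (at w)" by metis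
  then have "((\<lambda>z. \<Sum>\<alpha>\<in>K. c \<alpha> * (\<phi> \<alpha> z * (z - w) ^ n)) \<longlongrightarrow> (\<Sum>\<alpha>\<in>K. c \<alpha> * l \<alpha>)) (at w)"
    by (intro tendsto_intros)
  then have lim: "((\<lambda>z. A z * (z - w) ^ n) \<longlongrightarrow> (\<Sum>\<alpha>\<in>K. c \<alpha> * l \<alpha>)) (at w)"
    by (simp add: A_def sum_distrib_right mult.assoc)
  have mero: "A meromorphic_on {w}" unfolding A_def by (intro meromorphic_intros \<phi>)
  have evA: "eventually (\<lambda>z. A z \<noteq> 0) (at w)" using nz by (simp add: A_def)
  have evn: "eventually (\<lambda>z. (z - w) ^ n \<noteq> 0) (at w)"
    using eventually_neq_at_within[of w w UNIV] by eventually_elim simp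
  have "zorder (\<lambda>z. A z * (z - w) ^ n) w = zorder A w + zorder (\<lambda>z. (z - w) ^ n) w"
    by (rule zorder_mult) (use evA evn mero in \<open>auto intro!: meromorphic_intros simp: eventually_frequently simp del: power_eq_0_iff\<close>)
  also have "zorder (\<lambda>z. (z - w) ^ n) w = int n"
    by (rule zorder_eqI[of UNIV _ "\<lambda>_. 1"]) auto
  finally have "zorder (\<lambda>z. A z * (z - w) ^ n) w < 0" using neg by simp
  moreover have "eventually (\<lambda>z. A z * (z - w) ^ n \<noteq> 0) (at w)"
    using evA evn by eventually_elim simp
  ultimately have "is_pole (\<lambda>z. A z * (z - w) ^ n) w"
    by (intro zorder_neg_imp_is_pole) (use mero in \<open>auto intro!: meromorphic_intros\<close>)
  with lim show False
    unfolding is_pole_def using not_tendsto_and_filterlim_at_infinity[of "at w"] by (metis at_neq_bot)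
qed

text \<open>This is Jensen's formula for \<open>A\<close>: zeros only raise the mean of ln |A|, and
  poles lower it by no more than the counting functions of the \<open>\<phi> \<alpha>\<close> allow.
  \<open>C\<close> and \<open>k\<close> come from the leading Laurent coefficient and the order of
  \<open>A\<close> at 0, so they do not depend on \<open>r\<close>.\<close>

lemma log_mean_lower_bound:
  fixes \<phi> :: "'a \<Rightarrow> complex \<Rightarrow> complex" and c :: "'a \<Rightarrow> complex"
  assumes K: "finite K" and \<phi>: "\<And>\<alpha>. \<alpha> \<in> K \<Longrightarrow> \<phi> \<alpha> meromorphic_on UNIV"
    and A_def: "A = (\<lambda>z. \<Sum>\<alpha>\<in>K. c \<alpha> * \<phi> \<alpha> z)"
    and nz: "\<forall>\<^sub>\<approx>z. A z \<noteq> 0"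
  shows "\<exists>C k. \<forall>r\<ge>1. (\<forall>z. norm z = r \<longrightarrow> A z \<noteq> 0 \<and> A analytic_on {z}) \<longrightarrow>
      (\<lambda>\<theta>. ln (norm (A (of_real r * cis \<theta>)))) integrable_on {0..2*pi} \<and>
      2 * pi * (C + k * ln r - (\<Sum>\<alpha>\<in>K. nevanlinna_N r (\<phi> \<alpha>))) \<le>
        integral {0..2*pi} (\<lambda>\<theta>. ln (norm (A (of_real r * cis \<theta>))))"
proof -
  have mero: "A meromorphic_on X" for X
    unfolding A_def by (intro meromorphic_intros meromorphic_on_subset[OF \<phi>]) auto
  have evA: "eventually (\<lambda>z. A z \<noteq> 0) (at w)" for w
    using eventually_cosparse_imp_eventually_at[OF nz] by auto
  define k where "k = zorder A 0"
  \<comment> \<open>Dividing by the power z^k makes the value at 0 finite and nonzero, as Jensen's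
    formula demands.\<close>
  define G where "G = (\<lambda>z. A z * z powi (- k))"
  define g where "g = remove_sings G"
  have meroG: "G meromorphic_on X" for X
    unfolding G_def by (intro meromorphic_intros mero)
  have g: "g nicely_meromorphic_on UNIV"
    unfolding g_def by (rule remove_sings_nicely_meromorphic[OF meroG])
  have evp: "eventually (\<lambda>z::complex. z powi (- k) \<noteq> 0) (at w)" for w
    using eventually_neq_at_within[of 0 w UNIV] by eventually_elim simp
  have evG: "eventually (\<lambda>z. G z \<noteq> 0) (at w)" for w
    using evA[of w] evp[of w] by eventually_elim (simp add: G_def)
  have evg: "eventually (\<lambda>z. g z = G z) (at w)" for w
    unfolding g_def using meroG[of "{w}"] by (intro eventually_remove_sings_eq_at) (simp add: meromorphic_at_iff)
  have zordG: "zorder g w = zorder A w + zorder (\<lambda>z. z powi (- k)) w" for w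
  proof -
    have "zorder g w = zorder G w" by (rule zorder_cong) (use evg in auto)
    also have "\<dots> = zorder A w + zorder (\<lambda>z. z powi (- k)) w"
      unfolding G_def
      by (rule zorder_mult[OF mero eventually_frequently[OF at_neq_bot evA] _
            eventually_frequently[OF at_neq_bot evp]]) (auto intro!: meromorphic_intros)
    finally show ?thesis .
  qed
  have "zorder (\<lambda>z. z powi (- k)) (0::complex) = - k * zorder (\<lambda>z. z) (0::complex)"
    by (rule zorder_power_int) (auto intro!: meromorphic_intros eventually_frequently eventually_neq_at_within)
  also have "zorder (\<lambda>z. z) (0::complex) = 1"
    by (rule zorder_eqI[of UNIV _ "\<lambda>_. 1"]) auto
  finally have zg0: "zorder g 0 = 0" by (simp add: zordG k_def)
  \<comment> \<open>A nicely meromorphic function that is not locally zero takes the value 0 only at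
    isolated zeros and at poles, and both have nonzero order.\<close>
  have g0: "g 0 \<noteq> 0"
  proof
    assume "g 0 = 0"
    have evg0: "eventually (\<lambda>z. g z \<noteq> 0) (at 0)" using evg[of 0] evG[of 0] by eventually_elim simp
    have "isolated_zero g 0 \<or> is_pole g 0"
      by (rule zero_or_pole[OF g _ \<open>g 0 = 0\<close> evg0]) auto
    moreover have "g meromorphic_on {0}" using g by (auto simp: nicely_meromorphic_on_def intro: meromorphic_on_subset)
    ultimately show False
      using zg0 zorder_isolated_zero_pos'[of g 0] isolated_pole_imp_neg_zorder[of g 0]
      by (auto simp: meromorphic_at_iff)
  qed
  have zord_ge: "zorder g w \<ge> - int (\<Sum>\<alpha>\<in>K. pole_mult (\<phi> \<alpha>) w)" if "w \<noteq> 0" for w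
  proof -
    have "zorder (\<lambda>z. z powi (- k)) w = 0"
      using that by (intro zorder_eq_0I) (auto intro!: analytic_intros)
    moreover have "zorder A w \<ge> - int (\<Sum>\<alpha>\<in>K. pole_mult (\<phi> \<alpha>) w)"
      unfolding A_def
      by (rule zorder_sum_ge[OF K]) (use evA[of w] in \<open>auto simp: A_def intro: meromorphic_on_subset[OF \<phi>]\<close>)
    ultimately show ?thesis by (simp add: zordG)
  qed
  show ?thesis
  proof (rule exI[of _ "ln (norm (g 0))"], rule exI[of _ "real_of_int k"], intro allI impI, goal_cases)
    case (1 r)
    define S where "S = {w \<in> ball 0 r. g w = 0}"
    have gA: "g z = A z * z powi (- k)" if "norm z = r" for z
    proof -
      have "G analytic_on {z}" unfolding G_def
        by (intro analytic_intros) (use 1 that in auto)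
      then show ?thesis by (simp add: g_def G_def)
    qed
    have circ: "g z \<noteq> 0" if "norm z = r" for z
      using gA[OF that] 1 that by auto
    have finS: "finite S" and
      J: "((\<lambda>\<theta>. ln (norm (g (of_real r * cis \<theta>)))) has_integral
           (2 * pi * (ln (norm (g 0)) + (\<Sum>w\<in>S. zorder g w * ln (r / norm w))))) {0..2*pi}"
      unfolding S_def using jensen_formula[OF g g0 _ circ] 1(1) by auto
    have eq: "ln (norm (A (of_real r * cis \<theta>))) = ln (norm (g (of_real r * cis \<theta>))) + k * ln r" for \<theta>
    proof -
      let ?z = "of_real r * cis \<theta>"
      have nz: "norm ?z = r" using 1 by (simp add: norm_mult)
      then have "norm (g ?z) = norm (A ?z) * r powr (- k)"
        using 1(1) by (simp add: gA norm_mult norm_power_int powr_real_of_int' flip: of_int_minus)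
      moreover have "norm (A ?z) > 0" using 1(2)[rule_format, OF nz] by simp
      ultimately show ?thesis using 1(1) by (simp add: ln_mult_pos ln_powr)
    qed
    have "((\<lambda>\<theta>. ln (norm (g (of_real r * cis \<theta>))) + k * ln r) has_integral
           (2 * pi * (ln (norm (g 0)) + (\<Sum>w\<in>S. zorder g w * ln (r / norm w))) + 2 * pi * (k * ln r))) {0..2*pi}"
      using has_integral_add[OF J has_integral_const_real[of "k * ln r" 0 "2*pi"]] by simp
    then have I: "((\<lambda>\<theta>. ln (norm (A (of_real r * cis \<theta>)))) has_integral
           (2 * pi * (ln (norm (g 0)) + (\<Sum>w\<in>S. zorder g w * ln (r / norm w))) + 2 * pi * (k * ln r))) {0..2*pi}"
      unfolding eq .
    have S: "w \<noteq> 0" "norm w < r" "ln (r / norm w) \<ge> 0" if "w \<in> S" for w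
    proof -
      show *: "w \<noteq> 0" "norm w < r" using that g0 by (auto simp: S_def)
      then show "ln (r / norm w) \<ge> 0" by simp
    qed
    have "(\<Sum>w\<in>S. zorder g w * ln (r / norm w)) \<ge> (\<Sum>w\<in>S. - real (\<Sum>\<alpha>\<in>K. pole_mult (\<phi> \<alpha>) w) * ln (r / norm w))"
    proof (rule sum_mono)
      fix w assume w: "w \<in> S"
      have "real_of_int (zorder g w) \<ge> real_of_int (- int (\<Sum>\<alpha>\<in>K. pole_mult (\<phi> \<alpha>) w))"
        using zord_ge[OF S(1)[OF w]] by (rule of_int_le_iff[THEN iffD2])
      then show "- real (\<Sum>\<alpha>\<in>K. pole_mult (\<phi> \<alpha>) w) * ln (r / norm w) \<le> zorder g w * ln (r / norm w)"
        using S[OF w] by (intro mult_right_mono) auto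
    qed
    moreover have "(\<Sum>w\<in>S. - real (\<Sum>\<alpha>\<in>K. pole_mult (\<phi> \<alpha>) w) * ln (r / norm w)) =
        - (\<Sum>\<alpha>\<in>K. \<Sum>w\<in>S. pole_mult (\<phi> \<alpha>) w * ln (r / norm w))"
      by (subst sum.swap) (simp add: sum_distrib_right sum_negf)
    moreover have "(\<Sum>\<alpha>\<in>K. \<Sum>w\<in>S. pole_mult (\<phi> \<alpha>) w * ln (r / norm w)) \<le> (\<Sum>\<alpha>\<in>K. nevanlinna_N r (\<phi> \<alpha>))"
    proof (rule sum_mono)
      fix \<alpha> assume \<alpha>: "\<alpha> \<in> K"
      define P where "P = {w. norm w \<le> r \<and> is_pole (\<phi> \<alpha>) w \<and> w \<noteq> 0}"
      have finP: "finite P" unfolding P_def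
        by (rule finite_subset[OF _ finite_poles_cball[OF \<phi>[OF \<alpha>], of r]]) auto
      have "(\<Sum>w\<in>S. pole_mult (\<phi> \<alpha>) w * ln (r / norm w)) = (\<Sum>w\<in>S \<inter> P. pole_mult (\<phi> \<alpha>) w * ln (r / norm w))"
        by (rule sum.mono_neutral_right) (use finS in \<open>auto simp: P_def pole_mult_def dest: S\<close>)
      also have "\<dots> \<le> (\<Sum>w\<in>P. pole_mult (\<phi> \<alpha>) w * ln (r / norm w))"
        by (rule sum_mono2[OF finP]) (auto simp: P_def)
      \<comment> \<open>The remaining term of \<open>nevanlinna_N\<close> belongs to a pole at 0 and
        is nonnegative because \<open>r\<close> is at least 1.\<close>
      also have "\<dots> \<le> nevanlinna_N r (\<phi> \<alpha>)"
        using nevanlinna_N_eq[OF \<phi>[OF \<alpha>], of r] 1(1) by (simp add: P_def)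
      finally show "(\<Sum>w\<in>S. pole_mult (\<phi> \<alpha>) w * ln (r / norm w)) \<le> nevanlinna_N r (\<phi> \<alpha>)" .
    qed
    ultimately have "ln (norm (g 0)) + k * ln r - (\<Sum>\<alpha>\<in>K. nevanlinna_N r (\<phi> \<alpha>)) \<le>
        ln (norm (g 0)) + (\<Sum>w\<in>S. zorder g w * ln (r / norm w)) + k * ln r" by linarith
    then have "2 * pi * (ln (norm (g 0)) + k * ln r - (\<Sum>\<alpha>\<in>K. nevanlinna_N r (\<phi> \<alpha>))) \<le>
        2 * pi * (ln (norm (g 0)) + (\<Sum>w\<in>S. zorder g w * ln (r / norm w)) + k * ln r)"
      by (intro mult_left_mono) auto
    with I show ?case
      by (auto simp: has_integral_iff algebra_simps)
  qed
qed

section \<open>Order below 1 against exponential decay in a half-plane\<close>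

lemma nevanlinna_order_less_1_bound:
  assumes "nevanlinna_order f < 1" "\<epsilon> > 0"
  shows "eventually (\<lambda>r. nevanlinna_T r f \<le> \<epsilon> * r) at_top"
proof -
  obtain q :: ereal where q: "nevanlinna_order f < q" "q < 1" using dense[OF assms(1)] by auto
  define \<rho> where "\<rho> = real_of_ereal (max q 0)"
  have q1: "max q 0 = ereal \<rho>" "\<rho> < 1"
    using q by (auto simp: \<rho>_def max_def) (cases q; auto)+
  have "eventually (\<lambda>r::real. ln_ext (nevanlinna_T r f) / ereal (ln r) < q) at_top"
    using q(1) unfolding nevanlinna_order_def by (rule Limsup_lessD)
  \<comment> \<open>An exponent below 1 makes \<open>r powr \<rho>\<close> negligible against every
    positive multiple of \<open>r\<close>.\<close>
  moreover have "eventually (\<lambda>r::real. r powr \<rho> \<le> \<epsilon> * r) at_top"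
    using q1(2) assms(2) by real_asymp
  ultimately show ?thesis using eventually_gt_at_top[of "1::real"]
  proof eventually_elim
    case (elim r)
    show ?case
    proof (cases "nevanlinna_T r f > 0")
      case True
      have "ereal (ln (nevanlinna_T r f) / ln r) < q"
        using elim True by (simp add: ln_ext_def)
      also have "q \<le> ereal \<rho>" by (simp flip: q1(1))
      finally have "ereal (ln (nevanlinna_T r f) / ln r) < ereal \<rho>" .
      then have "ln (nevanlinna_T r f) < \<rho> * ln r" using elim by (simp add: field_simps)
      then have "nevanlinna_T r f < exp (\<rho> * ln r)" using True by (metis exp_less_mono exp_ln)
      also have "\<dots> = r powr \<rho>" using elim by (simp add: powr_def)
      finally show ?thesis using elim by simp
    next
      case False
      have "0 \<le> \<epsilon> * r" using elim assms by simp
      with False show ?thesis by simp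
    qed
  qed
qed

text \<open>The function (cos + cos^2) / 2 lies below the positive part of cos and has an elementary
  primitive on the whole interval. It yields pi / 2 in place of the exact value 2, and any positive
  multiple of \<open>r\<close> serves the purpose.\<close>

lemma integral_max_0_cos_ge:
  assumes "0 \<le> r"
  shows "r * pi / 2 \<le> integral {0..2*pi} (\<lambda>\<theta>. max 0 (r * cos \<theta>))"
proof -
  have "((\<lambda>\<theta>. r * ((cos \<theta> + cos \<theta> ^ 2) / 2)) has_integral r * ((sin (2*pi) / 2 + (2*pi + sin (2*pi) * cos (2*pi)) / 4) - (sin 0 / 2 + (0 + sin 0 * cos 0) / 4))) {0..2*pi}"
  proof (intro has_integral_mult_right fundamental_theorem_of_calculus)
    fix x :: real
    have "((\<lambda>\<theta>. sin \<theta> / 2 + (\<theta> + sin \<theta> * cos \<theta>) / 4) has_real_derivative (cos x / 2 + (1 + cos x * cos x - sin x * sin x) / 4)) (at x within {0..2*pi})"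
      by (auto intro!: derivative_eq_intros)
    also have "cos x / 2 + (1 + cos x * cos x - sin x * sin x) / 4 = (cos x + cos x ^ 2) / 2"
      using sin_cos_squared_add[of x] unfolding power2_eq_square by argo
    finally show "((\<lambda>\<theta>. sin \<theta> / 2 + (\<theta> + sin \<theta> * cos \<theta>) / 4) has_vector_derivative (cos x + cos x ^ 2) / 2) (at x within {0..2*pi})"
      by (simp add: has_real_derivative_iff_has_vector_derivative)
  qed auto
  then have I: "((\<lambda>\<theta>. r * ((cos \<theta> + cos \<theta> ^ 2) / 2)) has_integral (r * pi / 2)) {0..2*pi}"
    by simp
  have "integral {0..2*pi} (\<lambda>\<theta>. r * ((cos \<theta> + cos \<theta> ^ 2) / 2)) \<le> integral {0..2*pi} (\<lambda>\<theta>. max 0 (r * cos \<theta>))"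
  proof (rule integral_le)
    fix x :: real
    have "(cos x + cos x ^ 2) / 2 \<le> max 0 (cos x)"
    proof (cases "cos x \<ge> 0")
      case True
      then have "cos x * cos x \<le> cos x * 1" by (intro mult_left_mono) auto
      then show ?thesis using True by (simp add: power2_eq_square)
    next
      case False
      then have "cos x * (1 + cos x) \<le> 0" using cos_ge_minus_one[of x] by (intro mult_nonpos_nonneg) linarith+
      then show ?thesis by (simp add: power2_eq_square algebra_simps)
    qed
    then have "r * ((cos x + cos x ^ 2) / 2) \<le> r * max 0 (cos x)"
      using assms by (rule mult_left_mono)
    also have "\<dots> = max 0 (r * cos x)" using assms by (simp add: max_mult_distrib_left)
    finally show "r * ((cos x + cos x ^ 2) / 2) \<le> max 0 (r * cos x)" .
  qed (use I in \<open>auto intro!: integrable_continuous_interval continuous_intros\<close>)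
  then show ?thesis unfolding integral_unique[OF I] .
qed

text \<open>A sparse set is countable, so the moduli of its points cannot fill an interval.\<close>

lemma exists_large_radius_avoiding:
  fixes B :: "complex set"
  assumes "B sparse_in UNIV"
  obtains r where "r > r0" "\<And>z. norm z = r \<Longrightarrow> z \<notin> B"
proof -
  have "countable (norm ` B)"
    using sparse_imp_countable[OF open_UNIV assms] by simp
  then have "\<not> {r0<..<r0+1} \<subseteq> norm ` B"
    using uncountable_open_interval[of r0 "r0+1"] countable_subset by auto
  then obtain r where r: "r \<in> {r0<..<r0+1}" "r \<notin> norm ` B" by blast
  show ?thesis
    by (rule that[of r]) (use r in auto)
qed

text \<open>This turns the sum in the decay bound into an exponential of \<open>ln_plus\<close>
  terms, whose circle means are the proximity functions \<open>nevanlinna_m\<close>.\<close>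

lemma sum_norm_le_exp_sum_ln_plus:
  fixes x :: "'a \<Rightarrow> complex"
  assumes "finite K"
  shows "(\<Sum>\<alpha>\<in>K. norm (x \<alpha>)) \<le> card K * exp (\<Sum>\<alpha>\<in>K. ln_plus (norm (x \<alpha>)))"
proof (rule sum_bounded_above)
  fix \<alpha> assume "\<alpha> \<in> K"
  have "norm (x \<alpha>) \<le> exp (ln_plus (norm (x \<alpha>)))"
    by (cases "x \<alpha> = 0") (auto simp: ln_plus_def max_def ln_ge_iff[symmetric] not_le intro: order.strict_implies_order)
  also have "\<dots> \<le> exp (\<Sum>\<alpha>\<in>K. ln_plus (norm (x \<alpha>)))"
    unfolding exp_le_cancel_iff
    by (rule member_le_sum) (use assms \<open>\<alpha> \<in> K\<close> in \<open>auto simp: ln_plus_def\<close>)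
  finally show "norm (x \<alpha>) \<le> exp (\<Sum>\<alpha>\<in>K. ln_plus (norm (x \<alpha>)))" .
qed

lemma ln_plus_circle_integrable:
  assumes "\<And>z. norm z = \<bar>r\<bar> \<Longrightarrow> f analytic_on {z}"
  shows "(\<lambda>\<theta>. ln_plus (norm (f (of_real r * cis \<theta>)))) integrable_on {0..2*pi}"
proof (rule integrable_continuous_interval)
  have "f analytic_on sphere 0 \<bar>r\<bar>"
    using assms by (subst analytic_on_analytic_at) auto
  then have "continuous_on (sphere 0 \<bar>r\<bar>) f"
    by (intro holomorphic_on_imp_continuous_on analytic_imp_holomorphic)
  then have "continuous_on {0..2*pi} (\<lambda>\<theta>. f (of_real r * cis \<theta>))"
    by (rule continuous_on_compose2) (auto intro!: continuous_intros simp: norm_mult)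
  \<comment> \<open>On norms, \<open>ln_plus\<close> agrees with \<open>ln (max 1 x)\<close>, whose
    argument stays away from 0; so continuity holds at zeros of \<open>f\<close> too.\<close>
  then have "continuous_on {0..2*pi} (\<lambda>\<theta>. ln (max 1 (norm (f (of_real r * cis \<theta>)))))"
    by (intro continuous_intros) (auto simp: max_def)
  moreover have "ln (max 1 x) = ln_plus x" if "x \<ge> 0" for x :: real
    using that by (cases "x = 0") (auto simp: ln_plus_def max_def)
  ultimately show "continuous_on {0..2*pi} (\<lambda>\<theta>. ln_plus (norm (f (of_real r * cis \<theta>))))"
    by simp
qed

text \<open>On a suitable circle the mean of ln |A| is at least -\<Sum> N(r, \<phi>) - O(ln r) by
  Jensen's formula, and at most \<Sum> m(r, \<phi>) - \<kappa> r / 4 + O(1) by the decay. So \<Sum>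
  T(r, \<phi>) is at least \<kappa> r / 4 - O(ln r), too much for orders below 1.\<close>

theorem no_exponential_decay:
  fixes \<phi> :: "'a \<Rightarrow> complex \<Rightarrow> complex" and c :: "'a \<Rightarrow> complex"
  assumes K: "finite K" and \<phi>: "\<And>\<alpha>. \<alpha> \<in> K \<Longrightarrow> \<phi> \<alpha> meromorphic_on UNIV"
    and ord: "\<And>\<alpha>. \<alpha> \<in> K \<Longrightarrow> nevanlinna_order (\<phi> \<alpha>) < 1"
    and \<kappa>: "\<kappa> > 0"
    and A_def: "A = (\<lambda>z. \<Sum>\<alpha>\<in>K. c \<alpha> * \<phi> \<alpha> z)"
    and bound: "\<forall>\<^sub>\<approx>z. norm (A z) \<le> M * (\<Sum>\<alpha>\<in>K. norm (\<phi> \<alpha> z)) * exp (- \<kappa> * max 0 (Re z))"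
  shows "\<forall>\<^sub>\<approx>z. A z = 0"
proof (rule ccontr)
  assume not: "\<not> ?thesis"
  have meroA: "A meromorphic_on UNIV" unfolding A_def by (intro meromorphic_intros \<phi>)
  then have nz: "\<forall>\<^sub>\<approx>z. A z \<noteq> 0"
    using meromorphic_imp_constant_or_avoid[OF meroA, of 0] not by auto
  obtain C k :: real where Ck: "\<forall>r\<ge>1. (\<forall>z. norm z = r \<longrightarrow> A z \<noteq> 0 \<and> A analytic_on {z}) \<longrightarrow>
      (\<lambda>\<theta>. ln (norm (A (of_real r * cis \<theta>)))) integrable_on {0..2*pi} \<and>
      2 * pi * (C + k * ln r - (\<Sum>\<alpha>\<in>K. nevanlinna_N r (\<phi> \<alpha>))) \<le>
        integral {0..2*pi} (\<lambda>\<theta>. ln (norm (A (of_real r * cis \<theta>))))"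
    using log_mean_lower_bound[OF K \<phi> A_def nz] by blast
  \<comment> \<open>\<open>M'\<close> absorbs \<open>M\<close> and the number of summands. The
    maximum with 1 and the added 1 make it at least 1, so that its logarithm can be split off also
    for empty \<open>K\<close> or nonpositive \<open>M\<close>.\<close>
  define M' where "M' = max 1 M * (card K + 1)"
  have M': "M' \<ge> 1" unfolding M'_def using mult_mono[of 1 "max 1 M" 1 "real (card K + 1)"] by simp
  \<comment> \<open>The mean of \<open>\<kappa> * max 0 (r * cos \<theta>)\<close> is at least
    \<open>\<kappa> / 4 * r\<close>. With this \<open>\<epsilon>\<close> the characteristics add up
    to at most half of that gain.\<close>
  define \<epsilon> where "\<epsilon> = \<kappa> / (8 * (card K + 1))"
  have \<epsilon>: "\<epsilon> > 0" using \<kappa> by (simp add: \<epsilon>_def)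
  have "eventually (\<lambda>r. \<forall>\<alpha>\<in>K. nevanlinna_T r (\<phi> \<alpha>) \<le> \<epsilon> * r) at_top"
    using K nevanlinna_order_less_1_bound[OF ord \<epsilon>] by (simp add: eventually_ball_finite_distrib)
  moreover have "eventually (\<lambda>r. C + k * ln r + \<kappa> / 4 * r - ln M' > \<kappa> / 8 * r) at_top"
    using \<kappa> by real_asymp
  ultimately have "eventually (\<lambda>r. r \<ge> 1 \<and> (\<forall>\<alpha>\<in>K. nevanlinna_T r (\<phi> \<alpha>) \<le> \<epsilon> * r) \<and>
      C + k * ln r + \<kappa> / 4 * r - ln M' > \<kappa> / 8 * r) at_top"
    using eventually_ge_at_top[of "1::real"] by eventually_elim auto
  then obtain r0 where r0: "\<And>r. r > r0 \<Longrightarrow> r \<ge> 1 \<and> (\<forall>\<alpha>\<in>K. nevanlinna_T r (\<phi> \<alpha>) \<le> \<epsilon> * r) \<and>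
      C + k * ln r + \<kappa> / 4 * r - ln M' > \<kappa> / 8 * r"
    unfolding eventually_at_top_dense by blast
  have "\<forall>\<^sub>\<approx>z. \<forall>\<alpha>\<in>K. \<phi> \<alpha> analytic_on {z}"
    using K \<phi> by (auto simp: eventually_ball_finite_distrib intro!: meromorphic_on_imp_analytic_cosparse)
  with nz bound have "\<forall>\<^sub>\<approx>z. A z \<noteq> 0 \<and> (\<forall>\<alpha>\<in>K. \<phi> \<alpha> analytic_on {z}) \<and>
      norm (A z) \<le> M * (\<Sum>\<alpha>\<in>K. norm (\<phi> \<alpha> z)) * exp (- \<kappa> * max 0 (Re z))"
    by eventually_elim auto
  \<comment> \<open>One large circle avoids all exceptional points at once, so regularity and the
    decay bound hold at each of its points.\<close>
  then obtain r where "r > r0" and good: "\<And>z. norm z = r \<Longrightarrow> A z \<noteq> 0 \<and> (\<forall>\<alpha>\<in>K. \<phi> \<alpha> analytic_on {z}) \<and>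
      norm (A z) \<le> M * (\<Sum>\<alpha>\<in>K. norm (\<phi> \<alpha> z)) * exp (- \<kappa> * max 0 (Re z))"
    unfolding eventually_cosparse by (rule exists_large_radius_avoiding[of _ r0]) blast
  then have r: "r \<ge> 1" "\<forall>\<alpha>\<in>K. nevanlinna_T r (\<phi> \<alpha>) \<le> \<epsilon> * r" "C + k * ln r + \<kappa> / 4 * r - ln M' > \<kappa> / 8 * r"
    using r0[of r] by auto
  have int: "(\<lambda>\<theta>. ln_plus (norm (\<phi> \<alpha> (of_real r * cis \<theta>)))) integrable_on {0..2*pi}" if "\<alpha> \<in> K" for \<alpha>
    using that good r by (intro ln_plus_circle_integrable) auto
  have "A analytic_on {z}" if "norm z = r" for z
    unfolding A_def using good[OF that] by (intro analytic_intros) auto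
  with Ck r(1) good have lo: "(\<lambda>\<theta>. ln (norm (A (of_real r * cis \<theta>)))) integrable_on {0..2*pi}"
      "2 * pi * (C + k * ln r - (\<Sum>\<alpha>\<in>K. nevanlinna_N r (\<phi> \<alpha>))) \<le>
        integral {0..2*pi} (\<lambda>\<theta>. ln (norm (A (of_real r * cis \<theta>))))" by auto
  let ?U = "\<lambda>\<theta>. ln M' + (\<Sum>\<alpha>\<in>K. ln_plus (norm (\<phi> \<alpha> (of_real r * cis \<theta>)))) - \<kappa> * max 0 (r * cos \<theta>)"
  have imax: "(\<lambda>\<theta>. \<kappa> * max 0 (r * cos \<theta>)) integrable_on {0..2*pi}"
    by (intro integrable_continuous_interval continuous_intros)
  have intU: "?U integrable_on {0..2*pi}"
    by (intro integrable_diff integrable_add integrable_sum imax int K) auto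
  have "integral {0..2*pi} (\<lambda>\<theta>. ln (norm (A (of_real r * cis \<theta>)))) \<le> integral {0..2*pi} ?U"
  proof (rule integral_le[OF lo(1) intU])
    fix \<theta> :: real
    let ?z = "of_real r * cis \<theta>"
    have z: "norm ?z = r" using r by (simp add: norm_mult)
    have "norm (A ?z) \<le> M * (\<Sum>\<alpha>\<in>K. norm (\<phi> \<alpha> ?z)) * exp (- \<kappa> * max 0 (Re ?z))"
      using good[OF z] by blast
    also have "\<dots> \<le> max 1 M * ((card K + 1) * exp (\<Sum>\<alpha>\<in>K. ln_plus (norm (\<phi> \<alpha> ?z)))) * exp (- \<kappa> * max 0 (Re ?z))"
      by (intro mult_right_mono mult_mono order.trans[OF sum_norm_le_exp_sum_ln_plus[OF K]]) (auto intro!: sum_nonneg)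
    also have "\<dots> = M' * exp (\<Sum>\<alpha>\<in>K. ln_plus (norm (\<phi> \<alpha> ?z))) * exp (- \<kappa> * max 0 (Re ?z))"
      by (simp add: M'_def)
    finally have "ln (norm (A ?z)) \<le> ln (M' * exp (\<Sum>\<alpha>\<in>K. ln_plus (norm (\<phi> \<alpha> ?z))) * exp (- \<kappa> * max 0 (Re ?z)))"
      using good[OF z] by (intro ln_mono) auto
    also have "\<dots> = ?U \<theta>"
      using M' by (simp add: ln_mult_pos)
    finally show "ln (norm (A ?z)) \<le> ?U \<theta>" .
  qed
  also have "integral {0..2*pi} ?U = 2 * pi * ln M' + (\<Sum>\<alpha>\<in>K. 2 * pi * nevanlinna_m r (\<phi> \<alpha>)) - \<kappa> * integral {0..2*pi} (\<lambda>\<theta>. max 0 (r * cos \<theta>))"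
  proof (rule integral_unique)
    have "((\<lambda>\<theta>. ln_plus (norm (\<phi> \<alpha> (of_real r * cis \<theta>)))) has_integral 2 * pi * nevanlinna_m r (\<phi> \<alpha>)) {0..2*pi}"
      if "\<alpha> \<in> K" for \<alpha> using int[OF that] by (simp add: nevanlinna_m_def has_integral_integral)
    moreover have "((\<lambda>\<theta>. \<kappa> * max 0 (r * cos \<theta>)) has_integral \<kappa> * integral {0..2*pi} (\<lambda>\<theta>. max 0 (r * cos \<theta>))) {0..2*pi}"
      using integrable_integral[OF imax] by simp
    moreover have "((\<lambda>\<theta>. ln M') has_integral 2 * pi * ln M') {0..2*pi}"
      using has_integral_const_real[of "ln M'" 0 "2*pi"] by simp
    ultimately show "(?U has_integral 2 * pi * ln M' + (\<Sum>\<alpha>\<in>K. 2 * pi * nevanlinna_m r (\<phi> \<alpha>)) - \<kappa> * integral {0..2*pi} (\<lambda>\<theta>. max 0 (r * cos \<theta>))) {0..2*pi}"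
      by (intro has_integral_diff has_integral_add has_integral_sum K)
  qed
  also have "\<dots> \<le> 2 * pi * ln M' + (\<Sum>\<alpha>\<in>K. 2 * pi * nevanlinna_m r (\<phi> \<alpha>)) - \<kappa> * (r * pi / 2)"
    using integral_max_0_cos_ge[of r] r \<kappa> by (intro diff_left_mono mult_left_mono) auto
  also have "\<dots> = 2 * pi * (ln M' + (\<Sum>\<alpha>\<in>K. nevanlinna_m r (\<phi> \<alpha>)) - \<kappa> / 4 * r)"
    by (simp add: algebra_simps sum_distrib_left)
  finally have "2 * pi * (C + k * ln r - (\<Sum>\<alpha>\<in>K. nevanlinna_N r (\<phi> \<alpha>))) \<le>
      2 * pi * (ln M' + (\<Sum>\<alpha>\<in>K. nevanlinna_m r (\<phi> \<alpha>)) - \<kappa> / 4 * r)"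
    using lo(2) by linarith
  then have "C + k * ln r - (\<Sum>\<alpha>\<in>K. nevanlinna_N r (\<phi> \<alpha>)) \<le> ln M' + (\<Sum>\<alpha>\<in>K. nevanlinna_m r (\<phi> \<alpha>)) - \<kappa> / 4 * r"
    by (rule mult_left_le_imp_le) auto
  moreover have "(\<Sum>\<alpha>\<in>K. nevanlinna_N r (\<phi> \<alpha>)) + (\<Sum>\<alpha>\<in>K. nevanlinna_m r (\<phi> \<alpha>)) = (\<Sum>\<alpha>\<in>K. nevanlinna_T r (\<phi> \<alpha>))"
    by (simp add: nevanlinna_T_def sum.distrib)
  moreover have "(\<Sum>\<alpha>\<in>K. nevanlinna_T r (\<phi> \<alpha>)) \<le> card K * (\<epsilon> * r)"
    using r(2) by (intro sum_bounded_above) auto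
  moreover have "card K * (\<epsilon> * r) \<le> \<kappa> / 8 * r"
    using r(1) \<kappa> by (simp add: \<epsilon>_def field_simps)
  ultimately show False using r(3) by linarith
qed

section \<open>Continuation of the zeta function\<close>

text \<open>
  The alternating zeta series is continued by Euler's transform: passing from \<open>k\<close>-th to
  \<open>(k+1)\<close>-th differences of the terms extends the half-plane of convergence by \<open>1\<close> to the left.
\<close>

fun powr_delta :: "nat \<Rightarrow> complex \<Rightarrow> complex \<Rightarrow> complex" where
  "powr_delta 0 s x = x powr (- s)"
| "powr_delta (Suc k) s x = powr_delta k s x - powr_delta k s (x + 1)"

lemma powr_delta_has_field_derivative:
  "Re x > 0 \<Longrightarrow> (powr_delta k s has_field_derivative - s * powr_delta k (s + 1) x) (at x)"
proof (induction k arbitrary: x)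
  case 0
  have "x \<notin> \<real>\<^sub>\<le>\<^sub>0" using 0 by (auto simp: complex_nonpos_Reals_iff)
  from has_field_derivative_powr[OF this, of "- s"] show ?case by (simp add: diff_diff_eq)
next
  case (Suc k)
  have "((\<lambda>x. powr_delta k s (x + 1)) has_field_derivative - s * powr_delta k (s + 1) (x + 1)) (at x)"
    using Suc.IH[of "x + 1"] Suc.prems by (simp add: DERIV_shift)
  with Suc.IH[OF Suc.prems]
  have "((\<lambda>x. powr_delta k s x - powr_delta k s (x + 1)) has_field_derivative
          - s * powr_delta k (s + 1) x - - s * powr_delta k (s + 1) (x + 1)) (at x)"
    by (rule DERIV_diff)
  then show ?case by (simp add: algebra_simps)
qed

text \<open>Each difference is bounded by the derivative on the segment from x to x + 1, which costs
  a factor |s + i| and gains one power of x. This gain is what moves the half-plane of convergence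
  to the left.\<close>

lemma norm_powr_delta_le:
  assumes "x > 0" "Re s + k \<ge> 0"
  shows "norm (powr_delta k s (of_real x)) \<le> (\<Prod>i<k. norm (s + of_nat i)) * x powr (- (Re s + k))"
  using assms
proof (induction k arbitrary: s x)
  case 0
  then show ?case by (simp add: norm_powr_real_powr)
next
  case (Suc k)
  define B where "B = (\<Prod>i<k. norm (s + 1 + of_nat i)) * x powr (- (Re s + Suc k))"
  define S where "S = closed_segment (of_real x) (of_real x + 1 :: complex)"
  have "norm (powr_delta k s (of_real x) - powr_delta k s (of_real x + 1)) \<le>
          norm s * B * norm (of_real x - (of_real x + 1) :: complex)"
  proof (rule field_differentiable_bound[of S])
    fix z assume "z \<in> S"
    then obtain y where y: "z = of_real y" "x \<le> y"
      unfolding S_def by (auto simp: closed_segment_def algebra_simps scaleR_conv_of_real intro!: that[of "x + u" for u])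
    have "Re z > 0" using y Suc.prems by simp
    then show "(powr_delta k s has_field_derivative - s * powr_delta k (s + 1) z) (at z within S)"
      using powr_delta_has_field_derivative by (blast intro: has_field_derivative_at_within)
    have "norm (powr_delta k (s + 1) z) \<le> (\<Prod>i<k. norm (s + 1 + of_nat i)) * y powr (- (Re (s + 1) + k))"
      unfolding y(1) using Suc.prems y(2) by (intro Suc.IH) auto
    also have "\<dots> \<le> B"
      unfolding B_def using Suc.prems y(2)
      by (intro mult_mono prod_nonneg) (auto intro!: powr_mono2' simp: algebra_simps)
    finally show "norm (- s * powr_delta k (s + 1) z) \<le> norm s * B"
      by (simp add: norm_mult mult_left_mono)
  qed (auto simp: S_def)
  then show ?case
    by (simp add: B_def prod.lessThan_Suc_shift mult.assoc add.assoc add.commute add.left_commute del: prod.lessThan_Suc)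
qed

lemma powr_delta_holomorphic: "Re x > 0 \<Longrightarrow> (\<lambda>s. powr_delta k s x) holomorphic_on A"
proof (induction k arbitrary: x)
  case 0
  then have "x \<noteq> 0" by auto
  then show ?case by (auto intro!: holomorphic_intros)
next
  case (Suc k)
  then show ?case by (auto intro!: holomorphic_intros)
qed

definition alt_diff_series :: "nat \<Rightarrow> complex \<Rightarrow> complex" where
  "alt_diff_series k s = suminf (\<lambda>n. (-1) ^ n * powr_delta k s (of_nat (Suc n)))"

lemma summable_Suc_powr: "a > 1 \<Longrightarrow> summable (\<lambda>n. real (Suc n) powr (- a))"
  using summable_real_powr_iff[of "- a"] summable_Suc_iff[of "\<lambda>n. real n powr (- a)"] by simp

lemma norm_alt_diff_term_le:
  assumes "Re s + k \<ge> 0"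
  shows "norm ((-1) ^ n * powr_delta k s (of_nat (Suc n))) \<le>
           (\<Prod>i<k. norm (s + of_nat i)) * real (Suc n) powr (- (Re s + k))"
  using norm_powr_delta_le[of "real (Suc n)" s k] assms by (simp add: norm_mult norm_power)

lemma alt_diff_series_sums:
  assumes "Re s + k > 1"
  shows "(\<lambda>n. (-1) ^ n * powr_delta k s (of_nat (Suc n))) sums alt_diff_series k s"
proof -
  have "summable (\<lambda>n. (-1) ^ n * powr_delta k s (of_nat (Suc n)))"
    by (rule summable_comparison_test'[OF summable_mult[OF summable_Suc_powr[OF assms]] norm_alt_diff_term_le])
       (use assms in auto)
  then show ?thesis unfolding alt_diff_series_def by (rule summable_sums)
qed

text \<open>Adding to the alternating series its own shift by one index turns the terms into
  differences; the shifted series lacks the first term.\<close>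

lemma alt_diff_series_Suc:
  assumes "Re s + k > 1"
  shows "alt_diff_series (Suc k) s = 2 * alt_diff_series k s - powr_delta k s 1"
proof -
  let ?a = "\<lambda>n. powr_delta k s (of_nat (Suc n))"
  have a: "(\<lambda>n. (-1) ^ n * ?a n) sums alt_diff_series k s"
    by (rule alt_diff_series_sums[OF assms])
  then have "(\<lambda>n. (-1) ^ Suc n * ?a (Suc n)) sums (alt_diff_series k s - (-1) ^ 0 * ?a 0)"
    by (subst sums_Suc_iff) simp
  from sums_add[OF a this]
  have "(\<lambda>n. (-1) ^ n * powr_delta (Suc k) s (of_nat (Suc n))) sums (2 * alt_diff_series k s - powr_delta k s 1)"
    by (simp add: algebra_simps)
  moreover have "(\<lambda>n. (-1) ^ n * powr_delta (Suc k) s (of_nat (Suc n))) sums alt_diff_series (Suc k) s"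
    by (rule alt_diff_series_sums) (use assms in auto)
  ultimately show ?thesis by (rule sums_unique2[symmetric])
qed

lemma alt_diff_series_holomorphic:
  "alt_diff_series k holomorphic_on {s. Re s + k > 1}"
proof (rule holomorphic_uniform_sequence[where f = "\<lambda>N s. \<Sum>n<N. (-1) ^ n * powr_delta k s (of_nat (Suc n))"])
  show op: "open {s. Re s + k > 1}"
    using open_halfspace_Re_gt[of "1 - real k"] by (simp add: algebra_simps)
  show "(\<lambda>s. \<Sum>n<N. (-1) ^ n * powr_delta k s (of_nat (Suc n))) holomorphic_on {s. Re s + k > 1}" for N
    by (intro holomorphic_intros powr_delta_holomorphic) auto
  fix s assume "s \<in> {s. Re s + k > 1}"
  then obtain d where d: "d > 0" "cball s d \<subseteq> {s. Re s + k > 1}"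
    using op open_contains_cball by blast
  \<comment> \<open>\<open>a\<close> is the minimum of \<open>Re t + k\<close> over the disc,
    attained at its leftmost point \<open>s - d\<close>; since that point lies in the half-plane,
    \<open>a\<close> exceeds 1.\<close>
  define a where "a = Re s - d + k"
  have "s - of_real d \<in> cball s d" using d by (simp add: dist_norm)
  then have "s - of_real d \<in> {s. Re s + k > 1}" using d(2) by blast
  then have a: "a > 1" by (simp add: a_def)
  have ge: "Re t + k \<ge> a" if "t \<in> cball s d" for t
    using that abs_Re_le_cmod[of "s - t"] by (auto simp: a_def dist_norm)
  have "compact ((\<lambda>t. \<Prod>i<k. norm (t + of_nat i)) ` cball s d)"
    by (intro compact_continuous_image continuous_intros compact_cball)
  then obtain C where C: "\<And>t. t \<in> cball s d \<Longrightarrow> (\<Prod>i<k. norm (t + of_nat i)) \<le> C"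
    by (meson bdd_above.E bounded_imp_bdd_above compact_imp_bounded imageI)
  have "uniform_limit (cball s d) (\<lambda>N s. \<Sum>n<N. (-1) ^ n * powr_delta k s (of_nat (Suc n))) (alt_diff_series k) sequentially"
    unfolding alt_diff_series_def
  proof (rule Weierstrass_m_test)
    fix n t assume t: "t \<in> cball s d"
    have "norm ((-1) ^ n * powr_delta k t (of_nat (Suc n))) \<le> (\<Prod>i<k. norm (t + of_nat i)) * real (Suc n) powr (- (Re t + k))"
      using ge[OF t] a by (intro norm_alt_diff_term_le) auto
    also have "\<dots> \<le> C * real (Suc n) powr (- a)"
      using C[OF t] ge[OF t] by (intro mult_mono powr_mono) (auto intro!: order.trans[OF prod_nonneg C[OF t]])
    finally show "norm ((-1) ^ n * powr_delta k t (of_nat (Suc n))) \<le> C * real (Suc n) powr (- a)" .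
  qed (intro summable_mult summable_Suc_powr a)
  then show "\<exists>d>0. cball s d \<subseteq> {s. 1 < Re s + real k} \<and>
      uniform_limit (cball s d) (\<lambda>N s. \<Sum>n<N. (-1) ^ n * powr_delta k s (of_nat (Suc n))) (alt_diff_series k) sequentially"
    using d by blast
qed

text \<open>This is Euler's transform after \<open>k\<close> steps: the recursion
  \<open>alt_diff_series_Suc\<close> solved for the series of lower index and iterated from index
  0.\<close>

definition eta_approx :: "nat \<Rightarrow> complex \<Rightarrow> complex" where
  "eta_approx k s = (\<Sum>j<k. powr_delta j s 1 / 2 ^ Suc j) + alt_diff_series k s / 2 ^ k"

lemma eta_approx_Suc: "Re s + k > 1 \<Longrightarrow> eta_approx (Suc k) s = eta_approx k s"
  by (simp add: eta_approx_def alt_diff_series_Suc field_simps)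

lemma eta_approx_le: "k \<le> l \<Longrightarrow> Re s + k > 1 \<Longrightarrow> eta_approx l s = eta_approx k s"
  by (induction l rule: dec_induct) (auto simp: eta_approx_Suc)

lemma entire_eta:
  obtains \<eta> where "\<eta> holomorphic_on UNIV"
    "\<And>s. Re s > 1 \<Longrightarrow> (\<lambda>n. (-1) ^ n * of_nat (Suc n) powr (- s)) sums \<eta> s"
proof
  \<comment> \<open>The index makes \<open>Re s + k\<close> at least 2. It varies with
    \<open>s\<close>, but all admissible indices give the same value, so near each point \<eta>
    coincides with one fixed holomorphic \<open>eta_approx k\<close>.\<close>
  define \<eta> where "\<eta> = (\<lambda>s. eta_approx (nat \<lceil>2 - Re s\<rceil>) s)"
  have eq: "\<eta> s = eta_approx k s" if "Re s + k > 1" for s k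
  proof -
    have "Re s + nat \<lceil>2 - Re s\<rceil> > 1" by linarith
    with that show ?thesis unfolding \<eta>_def
      by (metis eta_approx_le linorder_le_cases)
  qed
  show "\<eta> holomorphic_on UNIV"
  proof -
    have "\<eta> analytic_on {s}" for s
    proof -
      define k where "k = nat \<lceil>2 - Re s\<rceil>"
      have op: "open {s. Re s + k > 1}"
        using open_halfspace_Re_gt[of "1 - real k"] by (simp add: algebra_simps)
      have "eta_approx k holomorphic_on {s. Re s + k > 1}"
        unfolding eta_approx_def
        by (intro holomorphic_intros alt_diff_series_holomorphic powr_delta_holomorphic) auto
      then have "\<eta> holomorphic_on {s. Re s + k > 1}"
        by (rule holomorphic_transform) (simp add: eq)
      moreover have "s \<in> {s. Re s + k > 1}" unfolding k_def by (simp; linarith)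
      ultimately show ?thesis using op analytic_at by blast
    qed
    then show ?thesis using analytic_imp_holomorphic analytic_on_analytic_at by blast
  qed
  fix s :: complex assume s: "Re s > 1"
  then have "\<eta> s = alt_diff_series 0 s" using eq[of s 0] by (simp add: eta_approx_def)
  then show "(\<lambda>n. (-1) ^ n * of_nat (Suc n) powr (- s)) sums \<eta> s"
    using alt_diff_series_sums[of s 0] s by simp
qed

section \<open>Existence and uniqueness of the continued zeta function\<close>

lemma zeta_series_sums:
  assumes "Re s > 1"
  shows "summable (\<lambda>n. norm (of_nat (Suc n) powr (- s)))"
    and "(\<lambda>n. of_nat (Suc n) powr (- s)) sums (suminf (\<lambda>n. 1 / of_nat (Suc n) powr s))"
proof -
  have "norm (of_nat (Suc n) powr (- s)) = real (Suc n) powr (- Re s)" for n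
    by (subst norm_powr_real_powr) auto
  then show *: "summable (\<lambda>n. norm (of_nat (Suc n) powr (- s)))"
    using summable_Suc_powr[OF assms] by (simp del: of_nat_Suc)
  show "(\<lambda>n. of_nat (Suc n) powr (- s)) sums (suminf (\<lambda>n. 1 / of_nat (Suc n) powr s))"
    using summable_sums[OF summable_norm_cancel[OF *]] by (simp add: powr_minus inverse_eq_divide)
qed

text \<open>In z - e only the even integers survive, each term doubled, and they sum to 2 * 2^(-s) *
  z. As index \<open>n\<close> stands for the integer \<open>Suc n\<close>, even integers sit at odd
  indices.\<close>

lemma eta_zeta_series:
  assumes s: "Re s > 1" and e: "(\<lambda>n. (-1) ^ n * of_nat (Suc n) powr (- s)) sums e"
    and z: "(\<lambda>n. of_nat (Suc n) powr (- s)) sums z"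
  shows "e = (1 - 2 powr (1 - s)) * z"
proof -
  let ?f = "\<lambda>n. of_nat (Suc n) powr (- s) - (-1) ^ n * of_nat (Suc n) powr (- s) :: complex"
  have "?f sums (z - e)" by (rule sums_diff[OF z e])
  moreover have "(\<lambda>n. ?f (2 * n + 1)) sums (z - e) \<longleftrightarrow> ?f sums (z - e)"
  proof (rule sums_mono_reindex)
    fix n :: nat assume "n \<notin> range (\<lambda>n. 2 * n + 1)"
    then have "even n" by (metis oddE rangeI)
    then show "?f n = 0" by simp
  qed (auto simp: strict_mono_def)
  moreover have "?f (2 * n + 1) = 2 * 2 powr (- s) * of_nat (Suc n) powr (- s)" for n
  proof -
    have "of_nat (Suc (2 * n + 1)) = (2 * of_nat (Suc n) :: complex)" by simp
    moreover have "(2 * of_nat (Suc n) :: complex) powr (- s) = 2 powr (- s) * of_nat (Suc n) powr (- s)"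
      by (rule powr_times_real) auto
    ultimately show ?thesis by (simp del: of_nat_Suc)
  qed
  ultimately have "(\<lambda>n. 2 * 2 powr (- s) * of_nat (Suc n) powr (- s)) sums (z - e)"
    by (simp only:)
  moreover have "(\<lambda>n. 2 * 2 powr (- s) * of_nat (Suc n) powr (- s)) sums (2 * 2 powr (- s) * z)"
    by (intro sums_mult z)
  ultimately have "z - e = 2 * 2 powr (- s) * z" by (rule sums_unique2)
  moreover have "2 powr (1 - s) = 2 * 2 powr (- s)" by (simp add: powr_diff powr_minus field_simps)
  ultimately show ?thesis by (simp add: algebra_simps)
qed

text \<open>By the identity theorem the functions agree off a sparse set; at an exceptional point
  the value is forced as well, being the limit, or 0 at a pole. This gives the uniqueness behind the
  definite description of \<open>riemann_zeta\<close>.\<close>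

lemma nicely_meromorphic_eqI:
  assumes f: "f nicely_meromorphic_on UNIV" and g: "g nicely_meromorphic_on UNIV"
    and U: "open U" "U \<noteq> {}" and eq: "\<And>z. z \<in> U \<Longrightarrow> f z = g z"
  shows "f = g"
proof
  fix w
  have "(\<lambda>z. f z - g z) meromorphic_on UNIV"
    using f g by (auto simp: nicely_meromorphic_on_def intro!: meromorphic_intros)
  then have "(\<forall>\<^sub>\<approx>z. f z - g z = 0) \<or> (\<forall>\<^sub>\<approx>z. f z - g z \<noteq> 0)"
    by (rule meromorphic_imp_constant_or_avoid) auto
  moreover have "\<not> (\<forall>\<^sub>\<approx>z. f z - g z \<noteq> 0)"
  proof
    assume *: "\<forall>\<^sub>\<approx>z. f z - g z \<noteq> 0"
    obtain u where u: "u \<in> U" using U by auto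
    have "eventually (\<lambda>z. f z - g z \<noteq> 0) (at u)"
      using eventually_cosparse_imp_eventually_at[OF *] by auto
    moreover have "eventually (\<lambda>z. z \<in> U) (at u)" using U(1) u by (rule eventually_at_in_open')
    ultimately have "eventually (\<lambda>_. False) (at u)" by eventually_elim (use eq in auto)
    then show False by simp
  qed
  ultimately have ev: "eventually (\<lambda>z. f z = g z) (at w)"
    using eventually_cosparse_imp_eventually_at[of "\<lambda>z. f z - g z = 0" UNIV w UNIV] by auto
  then have pole: "is_pole f w \<longleftrightarrow> is_pole g w" by (intro is_pole_cong) auto
  show "f w = g w"
  proof (cases "is_pole f w")
    case True
    then show ?thesis using pole is_pole_zero_at_nicely_mero[OF f, of w] is_pole_zero_at_nicely_mero[OF g, of w] by simp
  next
    case False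
    then have "(f \<longlongrightarrow> f w) (at w)" "(g \<longlongrightarrow> g w) (at w)"
      using f g pole by (auto simp: nicely_meromorphic_on_def)
    moreover from Lim_transform_eventually[OF this(1) ev] have "(g \<longlongrightarrow> f w) (at w)" .
    ultimately show ?thesis using tendsto_unique[OF at_neq_bot] by blast
  qed
qed

lemma riemann_zeta_exists:
  "\<exists>Z. Z nicely_meromorphic_on UNIV \<and> (\<forall>s. Re s > 1 \<longrightarrow> Z s = suminf (\<lambda>n. 1 / of_nat (Suc n) powr s))"
proof -
  obtain \<eta> where \<eta>: "\<eta> holomorphic_on UNIV"
    "\<And>s. Re s > 1 \<Longrightarrow> (\<lambda>n. (-1) ^ n * of_nat (Suc n) powr (- s)) sums \<eta> s"
    using entire_eta by blast
  have an: "\<eta> analytic_on A" for A using \<eta>(1) analytic_on_open[of UNIV \<eta>] analytic_on_subset by blast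
  \<comment> \<open>Zeros of the denominator may be poles or removable; \<open>remove_sings\<close>
    settles the values in either case.\<close>
  define F where "F = (\<lambda>s. \<eta> s / (1 - 2 powr (1 - s)))"
  have "F meromorphic_on UNIV"
    unfolding F_def by (intro meromorphic_intros analytic_on_imp_meromorphic_on an) (auto intro!: analytic_intros)
  then have "remove_sings F nicely_meromorphic_on UNIV" by (rule remove_sings_nicely_meromorphic)
  moreover have "remove_sings F s = suminf (\<lambda>n. 1 / of_nat (Suc n) powr s)" if s: "Re s > 1" for s
  proof -
    have "norm (2 powr (1 - s) :: complex) = 2 powr (1 - Re s)"
      by (subst norm_powr_real_powr) auto
    also have "\<dots> < 2 powr 0" using s by (intro powr_less_mono) auto
    finally have nz: "1 - 2 powr (1 - s) \<noteq> (0::complex)" by auto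
    then have "F analytic_on {s}" unfolding F_def by (intro analytic_intros an) auto
    then have "remove_sings F s = F s" by simp
    also have "\<dots> = suminf (\<lambda>n. 1 / of_nat (Suc n) powr s)"
      using eta_zeta_series[OF s \<eta>(2)[OF s] zeta_series_sums(2)[OF s]] nz by (simp add: F_def)
    finally show ?thesis .
  qed
  ultimately show ?thesis by blast
qed

lemma riemann_zeta_eq_series:
  assumes "Re s > 1"
  shows "riemann_zeta s = suminf (\<lambda>n. 1 / of_nat (Suc n) powr s)"
proof -
  let ?P = "\<lambda>Z. Z nicely_meromorphic_on UNIV \<and> (\<forall>s. Re s > 1 \<longrightarrow> Z s = suminf (\<lambda>n. 1 / of_nat (Suc n) powr s))"
  have "\<exists>!Z. ?P Z"
  proof (rule ex_ex1I[OF riemann_zeta_exists])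
    fix Z1 Z2 assume "?P Z1" "?P Z2"
    then show "Z1 = Z2"
      by (intro nicely_meromorphic_eqI[of _ _ "{s. Re s > 1}"]) (auto simp: open_halfspace_Re_gt intro: exI[of _ 2])
  qed
  from theI'[OF this] show ?thesis
    unfolding riemann_zeta_def using assms by blast
qed

lemma riemann_zeta_has_sum:
  assumes "Re s > 1"
  shows "((\<lambda>n. of_nat n powr (- s)) has_sum riemann_zeta s) {1..}"
proof -
  have "((\<lambda>n. of_nat (Suc n) powr (- s)) has_sum riemann_zeta s) UNIV"
    using zeta_series_sums[OF assms] riemann_zeta_eq_series[OF assms] by (intro norm_summable_imp_has_sum) auto
  also have "?this \<longleftrightarrow> ?thesis"
    by (rule has_sum_reindex_bij_witness[of _ "\<lambda>n. n - 1" Suc]) auto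
  finally show ?thesis .
qed

section \<open>Dirichlet coefficients of products of shifted zeta functions\<close>

text \<open>These are the Dirichlet coefficients of the product of the functions
  \<open>riemann_zeta (s + u)\<close> over the list, formed by iterated Dirichlet convolution.
  Exponents are encoded by repeated entries.\<close>

fun zeta_prod_coeff :: "complex list \<Rightarrow> nat \<Rightarrow> complex" where
  "zeta_prod_coeff [] n = (if n = 1 then 1 else 0)"
| "zeta_prod_coeff (u # us) n = (\<Sum>d | d dvd n. of_nat d powr (- u) * zeta_prod_coeff us (n div d))"

lemma has_sum_times:
  fixes f :: "'a \<Rightarrow> complex" and g :: "'b \<Rightarrow> complex"
  assumes f: "(f has_sum a) A" and g: "(g has_sum b) B"
  shows "((\<lambda>(x, y). f x * g y) has_sum (a * b)) (A \<times> B)"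
proof (rule has_sum_SigmaI[where g = "\<lambda>x. f x * b"])
  have f': "(\<lambda>x. norm (f x)) summable_on A" and g': "(\<lambda>y. norm (g y)) summable_on B"
    using has_sum_imp_summable[OF f] has_sum_imp_summable[OF g]
    by (simp_all only: summable_on_iff_abs_summable_on_complex)
  have "(\<lambda>p. norm (case p of (x, y) \<Rightarrow> f x * g y)) summable_on A \<times> B"
    by (subst Infinite_Sum.abs_summable_on_Sigma_iff)
       (use f' g' in \<open>auto simp: norm_mult infsum_cmult_right' simp: abs_mult infsum_nonneg intro!: summable_on_cmult_right summable_on_cmult_left\<close>)
  then show "(\<lambda>(x, y). f x * g y) summable_on A \<times> B"
    by (subst summable_on_iff_abs_summable_on_complex)
  show "((\<lambda>y. case (x, y) of (x, y) \<Rightarrow> f x * g y) has_sum f x * b) B" for x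
    using has_sum_cmult_right[OF g] by simp
qed (rule has_sum_cmult_left[OF f])

lemma zeta_prod_has_sum:
  assumes "\<And>u. u \<in> set us \<Longrightarrow> Re (s + u) > 1"
  shows "((\<lambda>n. zeta_prod_coeff us n * of_nat n powr (- s)) has_sum (\<Prod>u\<leftarrow>us. riemann_zeta (s + u))) {1..}"
  using assms
proof (induction us)
  case Nil
  have "((\<lambda>n. zeta_prod_coeff [] n * of_nat n powr (- s)) has_sum (\<Sum>n\<in>{1}. zeta_prod_coeff [] n * of_nat n powr (- s))) {1}"
    by (rule has_sum_finite) auto
  then have "((\<lambda>n. zeta_prod_coeff [] n * of_nat n powr (- s)) has_sum 1) {1}" by simp
  then show ?case
    by (subst has_sum_cong_neutral[of "{1}" _ _ "\<lambda>n. zeta_prod_coeff [] n * of_nat n powr (- s)"]) auto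
next
  case (Cons u us)
  let ?f = "\<lambda>(d, m). of_nat d powr (- (s + u)) * (zeta_prod_coeff us m * of_nat m powr (- s))"
  have "(?f has_sum (riemann_zeta (s + u) * (\<Prod>u\<leftarrow>us. riemann_zeta (s + u)))) ({1..} \<times> {1..})"
    by (intro has_sum_times riemann_zeta_has_sum Cons) (use Cons.prems in auto)
  \<comment> \<open>The double series over \<open>(d, m)\<close> is regrouped by the product
    \<open>n = d * m\<close>, with \<open>d\<close> running over the divisors of
    \<open>n\<close>.\<close>
  also have "?this \<longleftrightarrow> ((\<lambda>(n, d). ?f (d, n div d)) has_sum (riemann_zeta (s + u) * (\<Prod>u\<leftarrow>us. riemann_zeta (s + u))))
      (SIGMA n:{1..}. {d. d dvd n})"
    by (rule has_sum_reindex_bij_witness[of _ "\<lambda>(n, d). (d, n div d)" "\<lambda>(d, m). (d * m, d)"])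
       (auto elim!: dvdE)
  finally have "((\<lambda>n. \<Sum>d | d dvd n. ?f (d, n div d)) has_sum (riemann_zeta (s + u) * (\<Prod>u\<leftarrow>us. riemann_zeta (s + u)))) {1..}"
    by (rule has_sum_SigmaD) (auto intro!: has_sum_finiteI)
  also have "?this \<longleftrightarrow> ((\<lambda>n. zeta_prod_coeff (u # us) n * of_nat n powr (- s)) has_sum
      (riemann_zeta (s + u) * (\<Prod>u\<leftarrow>us. riemann_zeta (s + u)))) {1..}"
  proof (rule has_sum_cong)
    fix n :: nat assume n: "n \<in> {1..}"
    have "?f (d, n div d) = of_nat d powr (- u) * zeta_prod_coeff us (n div d) * of_nat n powr (- s)" if "d dvd n" for d
    proof -
      from that n obtain m where m: "n = d * m" "d > 0" "m > 0" by (auto elim!: dvdE)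
      have "(of_nat n :: complex) powr (- s) = of_nat d powr (- s) * of_nat m powr (- s)"
        unfolding m(1) of_nat_mult by (rule powr_times_real) auto
      moreover have "(of_nat d :: complex) powr (- (s + u)) = of_nat d powr (- s) * of_nat d powr (- u)"
        by (simp flip: powr_add)
      ultimately show ?thesis using m by simp
    qed
    then have "(\<Sum>d | d dvd n. ?f (d, n div d)) =
        (\<Sum>d | d dvd n. of_nat d powr (- u) * zeta_prod_coeff us (n div d) * of_nat n powr (- s))"
      by (intro sum.cong) auto
    then show "(\<Sum>d | d dvd n. ?f (d, n div d)) = zeta_prod_coeff (u # us) n * of_nat n powr (- s)"
      by (simp only: sum_distrib_right zeta_prod_coeff.simps)
  qed
  finally show ?case by (simp del: zeta_prod_coeff.simps)
qed

lemma zeta_prod_coeff_1 [simp]: "zeta_prod_coeff us (Suc 0) = 1"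
  by (induction us) auto

text \<open>Taking the gcd of a divisor with \<open>m\<close> and with \<open>n\<close> inverts the
  map from pairs of divisors to their product.\<close>

lemma sum_divisors_coprime_mult:
  fixes m n :: nat and F :: "nat \<Rightarrow> 'a :: comm_monoid_add"
  assumes "coprime m n" "m > 0" "n > 0"
  shows "(\<Sum>d | d dvd m * n. F d) = (\<Sum>a | a dvd m. \<Sum>b | b dvd n. F (a * b))"
proof -
  have gcds: "gcd (a * b) m = a" "gcd (a * b) n = b" if ab: "a dvd m" "b dvd n" for a b
  proof -
    have "coprime b m" "coprime a n" using ab assms by (meson coprime_commute coprime_divisors dvd_refl)+
    then have "gcd (a * b) m = gcd a m" "gcd (a * b) n = gcd b n"
      by (simp_all add: gcd_mult_left_right_cancel gcd_mult_left_left_cancel coprime_commute)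
    then show "gcd (a * b) m = a" "gcd (a * b) n = b" using ab by (auto simp: gcd_nat.absorb1)
  qed
  have gcd_prod: "gcd d m * gcd d n = d" if d: "d dvd m * n" for d
  proof -
    obtain a b where "d = a * b" "a dvd m" "b dvd n" using division_decomp[OF d] by blast
    then show ?thesis using gcds by simp
  qed
  have "(\<Sum>d | d dvd m * n. F d) = (\<Sum>(a, b)\<in>{a. a dvd m} \<times> {b. b dvd n}. F (a * b))"
  proof (rule sum.reindex_bij_witness[of _ "\<lambda>(a, b). a * b" "\<lambda>d. (gcd d m, gcd d n)"])
    fix d assume "d \<in> {d. d dvd m * n}"
    then show "(case (gcd d m, gcd d n) of (a, b) \<Rightarrow> a * b) = d" using gcd_prod by simp
  next
    fix ab assume "ab \<in> {a. a dvd m} \<times> {b. b dvd n}"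
    then show "(gcd (case ab of (a, b) \<Rightarrow> a * b) m, gcd (case ab of (a, b) \<Rightarrow> a * b) n) = ab"
      using gcds by auto
  next
    fix d assume "d \<in> {d. d dvd m * n}"
    then show "(case (gcd d m, gcd d n) of (a, b) \<Rightarrow> F (a * b)) = F d" using gcd_prod[of d] by simp
  qed (auto intro: mult_dvd_mono)
  then show ?thesis by (simp add: sum.cartesian_product)
qed

lemma zeta_prod_coeff_mult:
  assumes "coprime m n" "m > 0" "n > 0"
  shows "zeta_prod_coeff us (m * n) = zeta_prod_coeff us m * zeta_prod_coeff us n"
  using assms
proof (induction us arbitrary: m n)
  case Nil
  then show ?case by auto
next
  case (Cons u us)
  have "zeta_prod_coeff (u # us) (m * n) =
      (\<Sum>a | a dvd m. \<Sum>b | b dvd n. of_nat (a * b) powr (- u) * zeta_prod_coeff us (m * n div (a * b)))"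
    using sum_divisors_coprime_mult[OF Cons.prems] by (simp del: of_nat_mult)
  also have "\<dots> = (\<Sum>a | a dvd m. \<Sum>b | b dvd n.
      (of_nat a powr (- u) * zeta_prod_coeff us (m div a)) * (of_nat b powr (- u) * zeta_prod_coeff us (n div b)))"
  proof (intro sum.cong refl)
    fix a b assume "a \<in> {a. a dvd m}" "b \<in> {b. b dvd n}"
    then obtain a' b' where *: "m = a * a'" "n = b * b'" by (auto elim!: dvdE)
    have pos: "a > 0" "b > 0" "a' > 0" "b' > 0" using Cons.prems * by auto
    have "coprime a' b'" using Cons.prems * by auto
    then have "zeta_prod_coeff us (a' * b') = zeta_prod_coeff us a' * zeta_prod_coeff us b'"
      using pos by (intro Cons.IH)
    moreover have "m * n div (a * b) = a' * b'" using * pos by (simp add: div_mult_swap mult_ac)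
    moreover have "(of_nat (a * b) :: complex) powr (- u) = of_nat a powr (- u) * of_nat b powr (- u)"
      unfolding of_nat_mult by (rule powr_times_real) auto
    ultimately show "of_nat (a * b) powr (- u) * zeta_prod_coeff us (m * n div (a * b)) =
        (of_nat a powr (- u) * zeta_prod_coeff us (m div a)) * (of_nat b powr (- u) * zeta_prod_coeff us (n div b))"
      using * pos by simp
  qed
  also have "\<dots> = zeta_prod_coeff (u # us) m * zeta_prod_coeff (u # us) n"
    by (simp add: sum_product)
  finally show ?case .
qed

section \<open>Euler factors\<close>

lemma zeta_prod_coeff_prime_power:
  assumes p: "prime p"
  shows "zeta_prod_coeff (u # us) (p ^ e) = (\<Sum>i\<le>e. (of_nat p powr (- u)) ^ i * zeta_prod_coeff us (p ^ (e - i)))"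
proof -
  have p0: "p > 0" "p > 1" using p prime_gt_0_nat prime_gt_1_nat by auto
  have "{d. d dvd p ^ e} = (\<lambda>i. p ^ i) ` {..e}"
    using divides_primepow_nat[OF p] by auto
  moreover have "inj_on (\<lambda>i. p ^ i) {..e}" using p0 by (auto intro!: inj_onI)
  ultimately have "zeta_prod_coeff (u # us) (p ^ e) =
      (\<Sum>i\<le>e. of_nat (p ^ i) powr (- u) * zeta_prod_coeff us (p ^ e div p ^ i))"
    by (simp add: sum.reindex)
  also have "\<dots> = (\<Sum>i\<le>e. (of_nat p powr (- u)) ^ i * zeta_prod_coeff us (p ^ (e - i)))"
  proof (intro sum.cong refl arg_cong2[of _ _ _ _ "(*)"])
    fix i assume "i \<in> {..e}"
    then show "zeta_prod_coeff us (p ^ e div p ^ i) = zeta_prod_coeff us (p ^ (e - i))"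
      using p0 by (simp add: power_diff)
    show "of_nat (p ^ i) powr (- u) = ((of_nat p :: complex) powr (- u)) ^ i"
      by (induction i) (auto simp: powr_times_real)
  qed
  finally show ?thesis .
qed

text \<open>Prepending \<open>u\<close> multiplies the generating series at \<open>p\<close> by a
  geometric series in p^(-u) X, whose inverse is the new linear factor.\<close>

lemma euler_factor_fps:
  assumes p: "prime p"
  shows "Abs_fps (\<lambda>e. zeta_prod_coeff us (p ^ e)) * fps_of_poly (\<Prod>u\<leftarrow>us. [:1, - (of_nat p powr (- u)):]) = 1"
proof (induction us)
  case Nil
  have "Abs_fps (\<lambda>e. zeta_prod_coeff [] (p ^ e)) = 1"
    using p by (intro fps_ext) (auto simp: prime_nat_iff)
  then show ?case by simp
next
  case (Cons u us)
  let ?x = "of_nat p powr (- u) :: complex"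
  have "Abs_fps (\<lambda>e. zeta_prod_coeff (u # us) (p ^ e)) = Abs_fps (\<lambda>e. ?x ^ e) * Abs_fps (\<lambda>e. zeta_prod_coeff us (p ^ e))"
    by (intro fps_ext) (simp add: zeta_prod_coeff_prime_power[OF p] fps_mult_nth atLeast0AtMost del: zeta_prod_coeff.simps)
  then have "Abs_fps (\<lambda>e. zeta_prod_coeff (u # us) (p ^ e)) * fps_of_poly (\<Prod>u\<leftarrow>u # us. [:1, - (of_nat p powr (- u)):]) =
      (Abs_fps (\<lambda>e. ?x ^ e) * fps_of_poly [:1, - ?x:]) *
      (Abs_fps (\<lambda>e. zeta_prod_coeff us (p ^ e)) * fps_of_poly (\<Prod>u\<leftarrow>us. [:1, - (of_nat p powr (- u)):]))"
    by (simp only: list.map prod_list.Cons fps_of_poly_mult mult_ac)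
  moreover have "Abs_fps (\<lambda>e. ?x ^ e) * fps_of_poly [:1, - ?x:] = 1"
  proof (rule fps_ext)
    fix n
    show "fps_nth (Abs_fps (\<lambda>e. ?x ^ e) * fps_of_poly [:1, - ?x:]) n = fps_nth 1 n"
      by (cases n) (auto simp: fps_of_poly_pCons fps_mult_right_const_nth ring_distribs mult.assoc[symmetric])
  qed
  ultimately show ?case using Cons by (simp only: mult_1)
qed

lemma order_linear_factor:
  "order a [:1, - x:] = (if x * a = 1 then 1 else 0)" for a x :: complex
proof (cases "x * a = 1")
  case True
  then have "[:1, - x:] = smult (- x) [:- a, 1:]" "x \<noteq> 0" by auto
  then show ?thesis using True order_power_n_n[of a 1] by (simp add: order_smult del: smult_pCons)
next
  case False
  then have "poly [:1, - x:] a \<noteq> 0" by (simp add: mult.commute)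
  then show ?thesis using False by (simp add: order_0I)
qed

text \<open>Inverting the Euler factors gives equal polynomials \<open>P us\<close> and
  \<open>P vs\<close>. The multiplicity of the root p^w counts the entries \<open>u\<close> with
  p^(-u) = p^(-w), and by injectivity these are the entries equal to \<open>w\<close>.\<close>

lemma mset_eq_if_euler_factors_eq:
  assumes p: "prime p" and inj: "inj_on (\<lambda>u. of_nat p powr (- u) :: complex) (set us \<union> set vs)"
    and eq: "\<And>e. zeta_prod_coeff us (p ^ e) = zeta_prod_coeff vs (p ^ e)"
  shows "mset us = mset vs"
proof (rule multiset_eqI)
  define P where "P = (\<lambda>us. \<Prod>u\<leftarrow>us. [:1, - (of_nat p powr (- u)) :: complex:])"
  have "fps_of_poly (P us) = fps_of_poly (P vs)"
  proof -
    define F where "F = Abs_fps (\<lambda>e. zeta_prod_coeff us (p ^ e))"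
    have "F * fps_of_poly (P us) = 1" "F * fps_of_poly (P vs) = 1"
      using euler_factor_fps[OF p, of us] euler_factor_fps[OF p, of vs] eq by (simp_all add: P_def F_def)
    then have "F * fps_of_poly (P us) = F * fps_of_poly (P vs)" "F \<noteq> 0" by auto
    then show ?thesis by simp
  qed
  then have P: "P us = P vs" by (simp add: fps_of_poly_eq_iff)
  have p0: "(of_nat p :: complex) \<noteq> 0" using p by auto
  have ord: "order (of_nat p powr w) (P us) = count (mset us) w"
    if "inj_on (\<lambda>u. of_nat p powr (- u) :: complex) (insert w (set us))" for us w
    using that
  proof (induction us)
    case Nil
    then show ?case by (simp add: P_def)
  next
    case (Cons u us)
    have nz: "P (u # us) \<noteq> 0" unfolding P_def prod_list_zero_iff by auto
    have IH: "order (of_nat p powr w) (P us) = count (mset us) w"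
      using Cons.prems by (intro Cons.IH) (auto intro: inj_on_subset)
    have "P (u # us) = [:1, - (of_nat p powr (- u)) :: complex:] * P us" by (simp add: P_def)
    then have "order (of_nat p powr w) (P (u # us)) = order (of_nat p powr w) [:1, - (of_nat p powr (- u)) :: complex:] + order (of_nat p powr w) (P us)"
      using nz by (metis order_mult)
    moreover have "of_nat p powr (- u) * of_nat p powr w = (1::complex) \<longleftrightarrow> of_nat p powr (- u) = (of_nat p powr (- w) :: complex)"
      using p0 by (auto simp: powr_minus field_simps)
    moreover have "of_nat p powr (- u) = (of_nat p powr (- w) :: complex) \<longleftrightarrow> u = w"
      using inj_on_eq_iff[OF Cons.prems, of u w] by simp
    ultimately show ?case using IH by (simp add: order_linear_factor)
  qed
  fix w
  show "count (mset us) w = count (mset vs) w"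
  proof (cases "w \<in> set us \<union> set vs")
    case True
    then have "insert w (set us) \<subseteq> set us \<union> set vs" "insert w (set vs) \<subseteq> set us \<union> set vs" by auto
    then show ?thesis
      using ord[OF inj_on_subset[OF inj]] P by metis
  next
    case False
    then have "w \<notin># mset us" "w \<notin># mset vs" by auto
    then show ?thesis by (simp only: not_in_iff)
  qed
qed

section \<open>Linear independence of the Dirichlet coefficients\<close>

lemma prime_powr_eq_unique:
  fixes u v :: complex
  assumes p: "prime p" and q: "prime q" and uv: "u \<noteq> v"
    and pe: "of_nat p powr (- u) = (of_nat p powr (- v) :: complex)"
    and qe: "of_nat q powr (- u) = (of_nat q powr (- v) :: complex)"
  shows "p = q"
proof -
  \<comment> \<open>Equal powers of \<open>p\<close> mean that (v - u) ln p is an integer multiple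
    of 2 pi i, nonzero since u and v differ.\<close>
  have aux: "\<exists>k::int. k \<noteq> 0 \<and> (v - u) * of_real (ln (real p)) = of_real (2 * pi * of_int k) * \<i>"
    if p: "prime p" and pe: "of_nat p powr (- u) = (of_nat p powr (- v) :: complex)" for p
  proof -
    have lp: "ln (real p) \<noteq> 0" using prime_gt_1_nat[OF p] by simp
    have p0: "of_nat p \<noteq> (0::complex)" using p by auto
    have "Ln (of_nat p) = of_real (ln (real p))"
      using prime_gt_0_nat[OF p] by (metis Ln_of_real of_nat_0_less_iff of_real_of_nat_eq)
    then have "exp (- u * of_real (ln (real p))) = exp (- v * of_real (ln (real p)))"
      using pe p0 by (simp add: powr_def)
    then obtain k :: int where k: "- u * of_real (ln (real p)) = - v * of_real (ln (real p)) + (of_int (2 * k) * pi) * \<i>"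
      unfolding exp_eq by blast
    then have "(v - u) * of_real (ln (real p)) = of_real (2 * pi * of_int k) * \<i>" by (simp add: algebra_simps)
    moreover have "k \<noteq> 0" using calculation uv lp by auto
    ultimately show ?thesis by (intro exI[of _ k]) simp
  qed
  obtain k where k: "k \<noteq> 0" "(v - u) * of_real (ln (real p)) = of_real (2 * pi * of_int k) * \<i>"
    using aux[OF p pe] by blast
  obtain l where l: "l \<noteq> 0" "(v - u) * of_real (ln (real q)) = of_real (2 * pi * of_int l) * \<i>"
    using aux[OF q qe] by blast
  have "(v - u) * of_real (ln (real p) * of_int l) = (v - u) * of_real (ln (real q) * of_int k)"
    using k(2) l(2) by (simp add: mult.assoc[symmetric]) 
  then have "of_real (ln (real p) * of_int l) = (of_real (ln (real q) * of_int k) :: complex)" using uv by simp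
  then have *: "ln (real p) * of_int l = ln (real q) * of_int k" unfolding of_real_eq_iff .
  \<comment> \<open>Eliminating v - u from both relations gives l ln p = k ln q, that is, p^|l| =
    q^|k|; unique factorization then forces p = q.\<close>
  have "ln (real (p ^ nat \<bar>l\<bar>)) = \<bar>ln (real p) * of_int l\<bar>"
    using prime_gt_0_nat[OF p] prime_ge_1_nat[OF p] by (simp add: ln_realpow abs_mult)
  also have "\<dots> = ln (real (q ^ nat \<bar>k\<bar>))"
    unfolding * using prime_gt_0_nat[OF q] prime_ge_1_nat[OF q] by (simp add: ln_realpow abs_mult)
  finally have "real (p ^ nat \<bar>l\<bar>) = real (q ^ nat \<bar>k\<bar>)"
    using prime_gt_0_nat[OF p] prime_gt_0_nat[OF q] by (subst (asm) ln_inj_iff) auto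
  then have "p ^ nat \<bar>l\<bar> = q ^ nat \<bar>k\<bar>" by (simp only: of_nat_eq_iff)
  moreover have "p dvd p ^ nat \<bar>l\<bar>" using l(1) by (intro dvd_power) auto
  ultimately have "p dvd q" using p prime_dvd_power by metis
  then show ?thesis using p q primes_dvd_imp_eq by blast
qed

text \<open>Each pair of distinct points of \<open>U\<close> spoils injectivity for at most one
  prime.\<close>

lemma finite_primes_not_inj:
  assumes "finite (U :: complex set)"
  shows "finite {p. prime p \<and> \<not> inj_on (\<lambda>u. of_nat p powr (- u) :: complex) U}"
proof (rule finite_subset)
  let ?B = "\<lambda>(u, v). {p. prime p \<and> u \<noteq> v \<and> of_nat p powr (- u) = (of_nat p powr (- v) :: complex)}"
  show "{p. prime p \<and> \<not> inj_on (\<lambda>u. of_nat p powr (- u) :: complex) U} \<subseteq> (\<Union>x\<in>U \<times> U. ?B x)"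
    by (auto simp: inj_on_def)
  have "finite (?B (u, v))" for u v
  proof (cases "?B (u, v) = {}")
    case True
    show ?thesis unfolding True by simp
  next
    case False
    then obtain p where "p \<in> ?B (u, v)" by blast
    then have "?B (u, v) \<subseteq> {p}" using prime_powr_eq_unique by auto
    then show ?thesis by (rule finite_subset) simp
  qed
  then show "finite (\<Union>x\<in>U \<times> U. ?B x)" using assms by (intro finite_UN_I) auto
qed

lemma exists_distinguishing_prime_power:
  assumes "mset us \<noteq> mset vs" "N > 0"
  obtains p e where "prime p" "coprime p N" "zeta_prod_coeff us (p ^ e) \<noteq> zeta_prod_coeff vs (p ^ e)"
proof -
  have "finite ({p. prime p \<and> \<not> inj_on (\<lambda>u. of_nat p powr (- u) :: complex) (set us \<union> set vs)} \<union> {p. p dvd N})"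
    using finite_primes_not_inj[of "set us \<union> set vs"] finite_divisors_nat[OF assms(2)] by simp
  then obtain p where p: "prime p" "p \<notin> {p. prime p \<and> \<not> inj_on (\<lambda>u. of_nat p powr (- u) :: complex) (set us \<union> set vs)} \<union> {p. p dvd N}"
    using primes_infinite by (metis (no_types, lifting) finite_subset mem_Collect_eq subsetI)
  then have "coprime p N" using prime_imp_coprime by auto
  with p mset_eq_if_euler_factors_eq[OF p(1)] assms(1) that show ?thesis by blast
qed

text \<open>This is Artin's argument: the relation at q n minus
  \<open>zeta_prod_coeff (us b) q\<close> times the relation at n eliminates \<open>b\<close>.
  Splitting the coefficient at q n needs n coprime to q, so the relations are tracked only for n
  coprime to \<open>N\<close>, and \<open>N\<close> gains the factor \<open>p\<close> in each
  step.\<close>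

lemma zeta_prod_coeff_linear_independent:
  assumes "finite K" "N > 0"
    and "\<And>a b. a \<in> K \<Longrightarrow> b \<in> K \<Longrightarrow> a \<noteq> b \<Longrightarrow> mset (us a) \<noteq> mset (us b)"
    and "\<And>n. n > 0 \<Longrightarrow> coprime n N \<Longrightarrow> (\<Sum>a\<in>K. c a * zeta_prod_coeff (us a) n) = 0"
    and "a \<in> K"
  shows "c a = 0"
  using assms
proof (induction K arbitrary: N c a rule: finite_induct)
  case (insert b K)
  have K: "c a = 0" if a: "a \<in> K" for a
  proof -
    have ne: "mset (us a) \<noteq> mset (us b)" using a insert.hyps(2) by (intro insert.prems(2)) auto
    obtain p e where p: "prime p" "coprime p N" "zeta_prod_coeff (us a) (p ^ e) \<noteq> zeta_prod_coeff (us b) (p ^ e)"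
      by (rule exists_distinguishing_prime_power[OF ne insert.prems(1)])
    let ?q = "p ^ e"
    have p0: "p > 0" using p(1) prime_gt_0_nat by blast
    have "c a * (zeta_prod_coeff (us a) ?q - zeta_prod_coeff (us b) ?q) = 0"
    proof (rule insert.IH[of "N * p" "\<lambda>a. c a * (zeta_prod_coeff (us a) ?q - zeta_prod_coeff (us b) ?q)" a])
      fix n assume n: "n > 0" "coprime n (N * p)"
      have cop: "coprime ?q n" "coprime (?q * n) N" "coprime n N"
        using n p(2) by (auto simp: coprime_commute)
      have "(\<Sum>a\<in>K. c a * (zeta_prod_coeff (us a) ?q - zeta_prod_coeff (us b) ?q) * zeta_prod_coeff (us a) n) =
            (\<Sum>a\<in>insert b K. c a * (zeta_prod_coeff (us a) ?q - zeta_prod_coeff (us b) ?q) * zeta_prod_coeff (us a) n)"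
        using insert.hyps by simp
      also have "\<dots> = (\<Sum>a\<in>insert b K. c a * zeta_prod_coeff (us a) (?q * n)) -
          zeta_prod_coeff (us b) ?q * (\<Sum>a\<in>insert b K. c a * zeta_prod_coeff (us a) n)"
        unfolding sum_distrib_left sum_subtractf[symmetric]
        using cop(1) n p0 by (intro sum.cong) (auto simp: zeta_prod_coeff_mult algebra_simps)
      also have "\<dots> = 0" using insert.prems(3) cop n p0 by simp
      finally show "(\<Sum>a\<in>K. c a * (zeta_prod_coeff (us a) ?q - zeta_prod_coeff (us b) ?q) * zeta_prod_coeff (us a) n) = 0" .
    next
      show "0 < N * p" using insert.prems(1) p0 by simp
    next
      show "mset (us a) \<noteq> mset (us b)" if "a \<in> K" "b \<in> K" "a \<noteq> b" for a b
        using that by (intro insert.prems(2)) auto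
    qed (rule a)
    then show ?thesis using p(3) by simp
  qed
  \<comment> \<open>Once all other coefficients vanish, the relation at n = 1 isolates
    \<open>c b\<close>, because every coefficient at 1 equals 1.\<close>
  moreover have "c b = 0" using insert.prems(3)[of 1] insert.hyps K by simp
  ultimately show ?case using insert.prems(4) by auto
next
  case empty
  from empty(4) show ?case by blast
qed

section \<open>Vanishing of coefficient functions\<close>

lemma norm_nat_powr: "norm (of_nat n powr (- s) :: complex) = real n powr (- Re s)"
  by (subst norm_powr_real_powr) auto

text \<open>For n > N, passing from x0 to Re s costs the factor n^(x0 - Re s), which is at most (N +
  1)^(x0 - Re s) as the exponent is not positive. What remains is the absolutely convergent series
  at x0.\<close>

lemma dirichlet_tail_bound:
  fixes a :: "nat \<Rightarrow> complex"
  assumes summ: "(\<lambda>n. a n * of_nat n powr (- of_real x0)) summable_on {1..}" and s: "x0 \<le> Re s"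
  shows "(\<lambda>n. a n * of_nat n powr (- s)) summable_on {1..}"
    and "norm (infsum (\<lambda>n. a n * of_nat n powr (- s)) {N<..}) \<le>
           infsum (\<lambda>n. norm (a n) * real n powr (- x0)) {1..} * real (N + 1) powr (x0 - Re s)"
proof -
  have abs0: "(\<lambda>n. norm (a n) * real n powr (- x0)) summable_on {1..}"
    using summ by (subst (asm) summable_on_iff_abs_summable_on_complex) (simp add: norm_mult norm_nat_powr)
  have le: "norm (a n * of_nat n powr (- s)) \<le> norm (a n) * real n powr (- x0) * real (k + 1) powr (x0 - Re s)"
    if "n > k" for n k
  proof -
    have "real n powr (- Re s) = real n powr (- x0) * real n powr (x0 - Re s)"
      by (simp flip: powr_add)
    also have "\<dots> \<le> real n powr (- x0) * real (k + 1) powr (x0 - Re s)"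
      using that s by (intro mult_left_mono powr_mono2') auto
    finally show ?thesis by (simp add: norm_mult norm_nat_powr mult_left_mono mult.assoc)
  qed
  have "(\<lambda>n. norm (a n * of_nat n powr (- s))) summable_on {1..}"
    by (rule Infinite_Sum.abs_summable_on_comparison_test'[OF abs0]) (use le[of 0] in auto)
  then show summs: "(\<lambda>n. a n * of_nat n powr (- s)) summable_on {1..}"
    by (simp add: summable_on_iff_abs_summable_on_complex)
  have sub: "{N<..} \<subseteq> {1..}" by auto
  have abs1: "(\<lambda>n. norm (a n) * real n powr (- x0)) summable_on {N<..}"
    using abs0 sub by (rule summable_on_subset_banach)
  have "(\<lambda>n. norm (a n * of_nat n powr (- s))) summable_on {N<..}"
    using \<open>(\<lambda>n. norm (a n * of_nat n powr (- s))) summable_on {1..}\<close> sub by (rule summable_on_subset_banach)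
  then have "norm (infsum (\<lambda>n. a n * of_nat n powr (- s)) {N<..}) \<le> infsum (\<lambda>n. norm (a n * of_nat n powr (- s))) {N<..}"
    by (rule norm_infsum_bound)
  also have "\<dots> \<le> infsum (\<lambda>n. norm (a n) * real n powr (- x0) * real (N + 1) powr (x0 - Re s)) {N<..}"
    using le[of N] by (intro infsum_mono summable_on_cmult_left abs1) (auto simp: \<open>(\<lambda>n. norm (a n * of_nat n powr (- s))) summable_on {N<..}\<close>)
  also have "\<dots> = infsum (\<lambda>n. norm (a n) * real n powr (- x0)) {N<..} * real (N + 1) powr (x0 - Re s)"
    by (rule infsum_cmult_left) (use abs1 in auto)
  also have "\<dots> \<le> infsum (\<lambda>n. norm (a n) * real n powr (- x0)) {1..} * real (N + 1) powr (x0 - Re s)"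
    using abs0 abs1 sub by (intro mult_right_mono infsum_mono_neutral) auto
  finally show "norm (infsum (\<lambda>n. a n * of_nat n powr (- s)) {N<..}) \<le>
           infsum (\<lambda>n. norm (a n) * real n powr (- x0)) {1..} * real (N + 1) powr (x0 - Re s)" .
qed

text \<open>By strong induction the terms before \<open>N\<close> vanish off a sparse set, so A_N(s)
  N^(-s) is minus the tail, of size (N + 1)^(-Re s). Hence A_N decays exponentially relative to the
  \<phi> and must vanish.\<close>

lemma dirichlet_coefficients_vanish:
  fixes \<phi> :: "'a \<Rightarrow> complex \<Rightarrow> complex" and a :: "'a \<Rightarrow> nat \<Rightarrow> complex"
  assumes K: "finite K" and \<phi>: "\<And>\<alpha>. \<alpha> \<in> K \<Longrightarrow> \<phi> \<alpha> meromorphic_on UNIV"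
    and ord: "\<And>\<alpha>. \<alpha> \<in> K \<Longrightarrow> nevanlinna_order (\<phi> \<alpha>) < 1"
    and x0: "x0 \<ge> 0"
    and summ: "\<And>\<alpha>. \<alpha> \<in> K \<Longrightarrow> (\<lambda>n. a \<alpha> n * of_nat n powr (- of_real x0)) summable_on {1..}"
    and zero: "\<forall>\<^sub>\<approx>s. x0 \<le> Re s \<longrightarrow> (\<Sum>\<alpha>\<in>K. \<phi> \<alpha> s * infsum (\<lambda>n. a \<alpha> n * of_nat n powr (- s)) {1..}) = 0"
    and N: "N > 0"
  shows "\<forall>\<^sub>\<approx>s. (\<Sum>\<alpha>\<in>K. a \<alpha> N * \<phi> \<alpha> s) = 0"
  using N
proof (induction N rule: less_induct)
  case (less N)
  define A where "A = (\<lambda>n s. \<Sum>\<alpha>\<in>K. a \<alpha> n * \<phi> \<alpha> s)"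
  \<comment> \<open>With this rate, \<open>exp (- \<kappa> * x)\<close> is (N / (N + 1))^x.\<close>
  define \<kappa> where "\<kappa> = ln (real (N + 1)) - ln (real N)"
  have \<kappa>: "\<kappa> > 0" using less.prems by (simp add: \<kappa>_def)
  define b where "b = (\<lambda>\<alpha>. infsum (\<lambda>n. norm (a \<alpha> n) * real n powr (- x0)) {1..})"
  have b0: "b \<alpha> \<ge> 0" for \<alpha> unfolding b_def by (intro infsum_nonneg) auto
  define B where "B = (\<Sum>\<alpha>\<in>K. b \<alpha>)"
  define M0 where "M0 = (\<Sum>\<alpha>\<in>K. norm (a \<alpha> N))"
  \<comment> \<open>The first summand serves \<open>Re s < x0\<close>, where A_N is bounded termwise
    and \<open>exp (\<kappa> * x0)\<close> outweighs the decay factor; the second serves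
    \<open>x0 \<le> Re s\<close>, where the tail bound applies.\<close>
  define M where "M = M0 * exp (\<kappa> * x0) + B * real (N + 1) powr x0"
  have pos: "B \<ge> 0" "M0 \<ge> 0" using b0 by (auto simp: B_def M0_def intro!: sum_nonneg)
  have "\<forall>\<^sub>\<approx>s. \<forall>n\<in>{1..<N}. A n s = 0"
    using less by (auto simp: eventually_ball_finite_distrib A_def)
  with zero have bound: "\<forall>\<^sub>\<approx>s. norm (A N s) \<le> M * (\<Sum>\<alpha>\<in>K. norm (\<phi> \<alpha> s)) * exp (- \<kappa> * max 0 (Re s))"
  proof eventually_elim
    case (elim s)
    define \<Phi> where "\<Phi> = (\<Sum>\<alpha>\<in>K. norm (\<phi> \<alpha> s))"
    have \<Phi>: "\<Phi> \<ge> 0" by (auto simp: \<Phi>_def intro!: sum_nonneg)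
    show ?case
    proof (cases "x0 \<le> Re s")
      case False
      have "norm (A N s) \<le> (\<Sum>\<alpha>\<in>K. norm (a \<alpha> N * \<phi> \<alpha> s))" unfolding A_def by (rule norm_sum)
      also have "\<dots> \<le> (\<Sum>\<alpha>\<in>K. M0 * norm (\<phi> \<alpha> s))"
        unfolding norm_mult M0_def using K
        by (intro sum_mono mult_right_mono member_le_sum) auto
      also have "\<dots> = M0 * \<Phi>" by (simp add: \<Phi>_def sum_distrib_left)
      also have "\<dots> \<le> (M0 * \<Phi>) * exp (\<kappa> * x0 - \<kappa> * max 0 (Re s))"
      proof -
        have "\<kappa> * max 0 (Re s) \<le> \<kappa> * x0" using \<kappa> False x0 by (intro mult_left_mono) auto
        then have "1 \<le> exp (\<kappa> * x0 - \<kappa> * max 0 (Re s))" by simp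
        from mult_left_mono[OF this, of "M0 * \<Phi>"] show ?thesis using pos \<Phi> by simp
      qed
      also have "\<dots> = (M0 * exp (\<kappa> * x0)) * \<Phi> * exp (- \<kappa> * max 0 (Re s))"
        by (simp add: exp_diff exp_minus field_simps)
      also have "\<dots> \<le> M * \<Phi> * exp (- \<kappa> * max 0 (Re s))"
        using pos \<Phi> by (intro mult_right_mono) (auto simp: M_def)
      finally show ?thesis by (simp add: \<Phi>_def)
    next
      case True
      define h where "h = (\<lambda>\<alpha>. infsum (\<lambda>n. a \<alpha> n * of_nat n powr (- s)) {N<..})"
      have h: "norm (h \<alpha>) \<le> B * real (N + 1) powr (x0 - Re s)" if "\<alpha> \<in> K" for \<alpha>
      proof -
        have "norm (h \<alpha>) \<le> b \<alpha> * real (N + 1) powr (x0 - Re s)"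
          unfolding h_def b_def by (rule dirichlet_tail_bound(2)[OF summ[OF that] True])
        also have "\<dots> \<le> B * real (N + 1) powr (x0 - Re s)"
          unfolding B_def using K that b0 by (intro mult_right_mono member_le_sum) auto
        finally show ?thesis .
      qed
      have split: "infsum (\<lambda>n. a \<alpha> n * of_nat n powr (- s)) {1..} = (\<Sum>n=1..N. a \<alpha> n * of_nat n powr (- s)) + h \<alpha>"
        if "\<alpha> \<in> K" for \<alpha>
      proof -
        have "{1..} = {1..N} \<union> {N<..}" using less.prems by auto
        moreover have "(\<lambda>n. a \<alpha> n * of_nat n powr (- s)) summable_on {N<..}"
          by (rule summable_on_subset_banach[OF dirichlet_tail_bound(1)[OF summ[OF that] True]]) auto
        moreover have "infsum F ({1..N} \<union> {N<..}) = infsum F {1..N} + infsum F {N<..}"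
          if "F summable_on {N<..}" for F :: "nat \<Rightarrow> complex"
          using that by (intro infsum_Un_disjoint) auto
        ultimately show ?thesis
          unfolding h_def by (simp del: One_nat_def)
      qed
      have "0 = (\<Sum>\<alpha>\<in>K. \<phi> \<alpha> s * ((\<Sum>n=1..N. a \<alpha> n * of_nat n powr (- s)) + h \<alpha>))"
        using elim(1) True split by simp
      also have "\<dots> = (\<Sum>n=1..N. A n s * of_nat n powr (- s)) + (\<Sum>\<alpha>\<in>K. \<phi> \<alpha> s * h \<alpha>)"
        by (subst distrib_left, subst sum.distrib, subst sum_distrib_left, subst sum.swap)
           (simp add: A_def sum_distrib_right sum_distrib_left mult_ac)
      also have "(\<Sum>n=1..N. A n s * of_nat n powr (- s)) = (\<Sum>n\<in>{N}. A n s * of_nat n powr (- s))"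
        by (rule sum.mono_neutral_right) (use elim(2) less.prems in auto)
      finally have "A N s * of_nat N powr (- s) = - (\<Sum>\<alpha>\<in>K. \<phi> \<alpha> s * h \<alpha>)"
        by (simp add: eq_neg_iff_add_eq_0)
      then have "norm (A N s) * real N powr (- Re s) = norm (\<Sum>\<alpha>\<in>K. \<phi> \<alpha> s * h \<alpha>)"
        by (metis norm_minus_cancel norm_mult norm_nat_powr)
      also have "\<dots> \<le> (\<Sum>\<alpha>\<in>K. norm (\<phi> \<alpha> s) * (B * real (N + 1) powr (x0 - Re s)))"
        by (rule sum_norm_le) (use h in \<open>auto simp: norm_mult intro!: mult_left_mono\<close>)
      also have "\<dots> = B * \<Phi> * real (N + 1) powr (x0 - Re s)"
        by (simp add: \<Phi>_def sum_distrib_left sum_distrib_right mult_ac)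
      finally have "norm (A N s) \<le> B * \<Phi> * real (N + 1) powr (x0 - Re s) * real N powr Re s"
        using less.prems by (simp add: powr_minus field_simps)
      also have "\<dots> = (B * real (N + 1) powr x0) * \<Phi> * (real (N + 1) powr (- Re s) * real N powr Re s)"
        by (simp add: powr_diff powr_minus field_simps)
      also have "real (N + 1) powr (- Re s) * real N powr Re s = exp (- \<kappa> * max 0 (Re s))"
        using less.prems True x0 by (simp add: powr_def \<kappa>_def algebra_simps flip: exp_add)
      also have "(B * real (N + 1) powr x0) * \<Phi> * exp (- \<kappa> * max 0 (Re s)) \<le> M * \<Phi> * exp (- \<kappa> * max 0 (Re s))"
        using pos \<Phi> by (intro mult_right_mono) (auto simp: M_def)
      finally show ?thesis by (simp add: \<Phi>_def)
    qed
  qed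
  have "A N = (\<lambda>s. \<Sum>\<alpha>\<in>K. a \<alpha> N * \<phi> \<alpha> s)" by (simp add: A_def)
  from no_exponential_decay[OF K _ _ \<kappa> this bound] \<phi> ord have "\<forall>\<^sub>\<approx>s. A N s = 0" by blast
  then show ?case by (simp add: A_def)
qed

section \<open>From exponent vectors to lists of shifts, and the conclusion\<close>

definition shift_list :: "(nat \<Rightarrow> complex) \<Rightarrow> nat \<Rightarrow> (nat \<Rightarrow> nat) \<Rightarrow> complex list" where
  "shift_list \<sigma> m e = concat (map (\<lambda>j. replicate (e j) (\<sigma> j)) [0..<Suc m])"

lemma prod_shift_list: "(\<Prod>u\<leftarrow>shift_list \<sigma> m e. g u) = (\<Prod>j\<le>m. g (\<sigma> j) ^ e j)"
  for g :: "complex \<Rightarrow> 'a :: comm_monoid_mult"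
  unfolding shift_list_def by (induction m) (auto simp: prod_list_replicate simp flip: mult.assoc)

lemma count_shift_list: "count (mset (shift_list \<sigma> m e)) w = (\<Sum>j\<le>m. if \<sigma> j = w then e j else 0)"
  unfolding shift_list_def by (induction m) auto

lemma set_shift_list: "set (shift_list \<sigma> m e) \<subseteq> \<sigma> ` {..m}"
  unfolding shift_list_def by (auto simp: less_Suc_eq_le)

lemma mset_shift_list_inj:
  assumes "inj_on \<sigma> {..m}" "mset (shift_list \<sigma> m d) = mset (shift_list \<sigma> m e)" "i \<le> m"
  shows "d i = e i"
proof -
  have "count (mset (shift_list \<sigma> m e)) (\<sigma> i) = e i" for e
  proof -
    have "count (mset (shift_list \<sigma> m e)) (\<sigma> i) = (\<Sum>j\<le>m. if j = i then e j else 0)"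
      unfolding count_shift_list using assms by (intro sum.cong) (auto simp: inj_on_def)
    then show ?thesis using assms(3) by simp
  qed
  from this[of d] this[of e] assms(2) show ?thesis by simp
qed

text \<open>Identities of meromorphic functions are expressed as equality off a sparse set, since
  values at poles are mere convention. The vanishing of coefficients is expressed in the same
  way.\<close>

theorem corollary1:
  fixes m :: nat and \<sigma> :: "nat \<Rightarrow> complex" and f :: fun_mpoly
  assumes "inj_on \<sigma> {..m}"
    and "vars_upto m f"
    and "\<And>\<alpha>. Poly_Mapping.lookup f \<alpha> meromorphic_on UNIV"
    and "\<And>\<alpha>. nevanlinna_order (Poly_Mapping.lookup f \<alpha>) < 1"
    and "\<forall>\<^sub>\<approx>s. eval_fun_mpoly m f s (\<lambda>j. riemann_zeta (s + \<sigma> j)) = 0"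
  shows "\<forall>\<alpha>. \<forall>\<^sub>\<approx>s. Poly_Mapping.lookup f \<alpha> s = 0"
proof
  define K where "K = Poly_Mapping.keys f"
  define us where "us = (\<lambda>\<alpha> :: nat \<Rightarrow>\<^sub>0 nat. shift_list \<sigma> m (Poly_Mapping.lookup \<alpha>))"
  define \<phi> where "\<phi> = Poly_Mapping.lookup f"
  have K: "finite K" by (simp add: K_def)
  have dist: "mset (us \<alpha>) \<noteq> mset (us \<beta>)" if "\<alpha> \<in> K" "\<beta> \<in> K" "\<alpha> \<noteq> \<beta>" for \<alpha> \<beta>
  proof
    assume eq: "mset (us \<alpha>) = mset (us \<beta>)"
    have "Poly_Mapping.lookup \<alpha> i = Poly_Mapping.lookup \<beta> i" for i
    proof (cases "i \<le> m")
      case True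
      then show ?thesis using mset_shift_list_inj[OF assms(1)] eq by (simp add: us_def)
    next
      case False
      then have "i \<notin> Poly_Mapping.keys \<alpha>" "i \<notin> Poly_Mapping.keys \<beta>"
        using assms(2) that by (auto simp: vars_upto_def K_def)
      then show ?thesis by (simp add: in_keys_iff)
    qed
    then show False using that(3) by (auto intro: poly_mapping_eqI)
  qed
  \<comment> \<open>The sum of absolute values dominates each shift, so every
    \<open>s + \<sigma> j\<close> has real part at least 2 once
    \<open>x0 \<le> Re s\<close>.\<close>
  define x0 where "x0 = 2 + (\<Sum>j\<le>m. \<bar>Re (\<sigma> j)\<bar>)"
  have x0: "x0 \<ge> 0" by (auto simp: x0_def intro!: add_nonneg_nonneg sum_nonneg)
  have conv: "((\<lambda>n. zeta_prod_coeff (us \<alpha>) n * of_nat n powr (- s)) has_sum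
      (\<Prod>j\<le>m. riemann_zeta (s + \<sigma> j) ^ Poly_Mapping.lookup \<alpha> j)) {1..}" if "x0 \<le> Re s" for s \<alpha>
    unfolding prod_shift_list[symmetric, of "\<lambda>u. riemann_zeta (s + u)"] us_def
  proof (rule zeta_prod_has_sum)
    fix u assume "u \<in> set (shift_list \<sigma> m (Poly_Mapping.lookup \<alpha>))"
    then obtain j where j: "j \<le> m" "u = \<sigma> j" using set_shift_list by blast
    have "\<bar>Re (\<sigma> j)\<bar> \<le> (\<Sum>j\<le>m. \<bar>Re (\<sigma> j)\<bar>)" using j by (intro member_le_sum) auto
    then show "Re (s + u) > 1" using that j by (simp add: x0_def)
  qed
  have vanish: "\<forall>\<^sub>\<approx>s. (\<Sum>\<alpha>\<in>K. zeta_prod_coeff (us \<alpha>) n * \<phi> \<alpha> s) = 0" if "n > 0" for n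
  proof (rule dirichlet_coefficients_vanish[OF K _ _ x0])
    show "\<phi> \<alpha> meromorphic_on UNIV" "nevanlinna_order (\<phi> \<alpha>) < 1" for \<alpha>
      using assms(3,4) by (simp_all add: \<phi>_def)
    show "(\<lambda>n. zeta_prod_coeff (us \<alpha>) n * of_nat n powr (- of_real x0)) summable_on {1..}" for \<alpha>
      by (rule has_sum_imp_summable[OF conv]) simp
    show "\<forall>\<^sub>\<approx>s. x0 \<le> Re s \<longrightarrow> (\<Sum>\<alpha>\<in>K. \<phi> \<alpha> s * infsum (\<lambda>n. zeta_prod_coeff (us \<alpha>) n * of_nat n powr (- s)) {1..}) = 0"
      using assms(5)
    proof eventually_elim
      case (elim s)
      then show ?case
        by (auto simp: eval_fun_mpoly_def K_def \<phi>_def infsumI[OF conv] simp del: One_nat_def)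
    qed
  qed (rule that)
  fix \<alpha>
  show "\<forall>\<^sub>\<approx>s. Poly_Mapping.lookup f \<alpha> s = 0"
  proof (rule ccontr)
    assume "\<not> ?thesis"
    then have nz: "\<forall>\<^sub>\<approx>s. \<phi> \<alpha> s \<noteq> 0"
      using meromorphic_imp_constant_or_avoid[OF assms(3)[of \<alpha>] open_UNIV connected_UNIV, of 0] by (auto simp: \<phi>_def)
    \<comment> \<open>A countable union of sparse sets need not be sparse, but it is countable.\<close>
    define E where "E = {s. \<phi> \<alpha> s = 0} \<union> (\<Union>n\<in>{0<..}. {s. (\<Sum>\<alpha>\<in>K. zeta_prod_coeff (us \<alpha>) n * \<phi> \<alpha> s) \<noteq> 0})"
    have "countable E"
      unfolding E_def
    proof (intro countable_Un countable_UN)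
      show "countable {s. \<phi> \<alpha> s = 0}"
        using sparse_imp_countable[OF open_UNIV] nz by (auto simp: eventually_cosparse)
      show "countable {s. (\<Sum>\<alpha>\<in>K. zeta_prod_coeff (us \<alpha>) n * \<phi> \<alpha> s) \<noteq> 0}" if "n \<in> {0<..}" for n
        using sparse_imp_countable[OF open_UNIV] vanish[of n] that by (auto simp: eventually_cosparse)
    qed auto
    then have "E \<noteq> UNIV" using uncountable_UNIV_complex by auto
    then obtain s where s: "s \<notin> E" by auto
    then have "\<alpha> \<in> K" by (auto simp: E_def \<phi>_def K_def in_keys_iff zero_fun_def)
    \<comment> \<open>At this single point all relations hold at once. They are linear relations
      with the constants \<open>\<phi> \<alpha> s\<close> as coefficients, so independence applies
      with \<open>N = 1\<close>, which imposes no coprimality condition.\<close>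
    then have "\<phi> \<alpha> s = 0"
      using s by (intro zeta_prod_coeff_linear_independent[OF K, of 1 us "\<lambda>\<alpha>. \<phi> \<alpha> s"] dist)
                 (auto simp: E_def mult.commute)
    then show False using s by (simp add: E_def)
  qed
qed

end
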